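(* Assume that the translates $\{\varphi(\cdot-k)\}_{k\in\Gamma}$ are linearly independent, and let $n\geq0$. Let $m_n=\#\Omega_n$, let $\Delta_n$ be the set of eigenvalues of $T_n$, let $\chi_{T_n}(x)=\prod_{\lambda\in\Delta_n}(x-\lambda)^{r_\lambda}$ be its characteristic polynomial (with $r_0=0$ if $0\notin\Delta_n$), and let $\mathcal{B}_n=\{v_1,\dots,v_{m_n}\}$ be a Jordan basis of row vectors for $T_n$. Then for every $\lambda\in\Delta_n$ with $\lambda\ne0$, $\dim\mathcal{H}_\lambda(\varphi)=r_\lambda$, and a basis of $\mathcal{H}_\lambda(\varphi)$ is given by the functions $h_{v_i}=Y_{v_i}\Phi$, where $v_i$ runs over the vectors of $\mathcal{B}_n$ associated to the eigenvalue $\lambda$. Consequently the space $\mathcal{H}=\bigoplus_{\lambda\in\Delta_n,\lambda\neq0}\mathcal{H}_\lambda(\varphi)\subset\mathcal{S}(\varphi)$ satisfies $\dim\mathcal{H}=m_n-r_0$.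
   Context: $\Gamma\subset\mathbb{R}^d$ is a lattice (the image of $\mathbb{Z}^d$ under a nonsingular linear map) and $A$ is a dilation matrix associated to $\Gamma$: a $d\times d$ real matrix with $A(\Gamma)\subset\Gamma$ all of whose eigenvalues have modulus $>1$. $\Lambda\subset\Gamma$ is finite and nonempty, $c_k\in\mathbb{C}$ for $k\in\Lambda$, $c_k=0$ for $k\in\Gamma\setminus\Lambda$. $\varphi:\mathbb{R}^d\to\mathbb{C}$ is a compactly supported function satisfying $\varphi(x)=\sum_{k\in\Lambda}c_k\varphi(Ax-k)$ for $x\in\mathbb{R}^d$. $\ell(\Gamma)$ is the space of all complex sequences $Y=\{y_k\}_{k\in\Gamma}$ (row vectors). $\Phi(x)=\{\varphi(x+k)\}_{k\in\Gamma}$ is an infinite column vector, and $Y\Phi(x)=\sum_{k\in\Gamma}y_k\varphi(x+k)$. $\mathcal{S}(\varphi)=\{Y\Phi: Y\in\ell(\Gamma)\}$. The translates are linearly independent if $\sum_{k\in\Gamma}\alpha_k\varphi(\cdot-k)\equiv0$ with $\{\alpha_k\}\in\ell(\Gamma)$ implies all $\alpha_k=0$. $L=[c_{Ai-j}]_{i,j\in\Gamma}$ acts on row vectors by $(YL)_j=\sum_iy_ic_{Ai-j}$ (finite sum for each $j$). A function $h:\mathbb{R}^d\to\mathbb{C}$ is in the class $\mathcal{H}(A,\lambda,r)$ ($\lambda\in\mathbb{C}$, $r\ge1$) if $\sum_{k=0}^r\binom{r}{k}(-\lambda)^kh(A^{k-r}x)=0$ for every $x\in\mathbb{R}^d$;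 equivalently $(D_A-\lambda I)^rh=0$ with $(D_Af)(x)=f(A^{-1}x)$. For $\lambda\in\Delta_n$, $\mathcal{H}_\lambda(\varphi)=\{h\in\mathcal{S}(\varphi): h\in\mathcal{H}(A,\lambda,k)\text{ for some }k\ge1\}$. For a finite nonempty $H\subset\Gamma$ and $B\subset\mathbb{R}^d$ let $w_H(B)=A^{-1}(B+H)$; $K_H$ is the unique nonempty compact set with $w_H(K_H)=K_H$, and $\Omega_H=K_H\cap\Gamma$. A set $\Omega\subset\Gamma$ is $H$-admissible if $w_H(\Omega)\cap\Gamma\subset\Omega$. $D\subset\Gamma$ is a full set of representatives of $\Gamma/A(\Gamma)$ with $0\in D$, such that the translates $K_D+k$, $k\in\Gamma$, of $Q=K_D$ cover $\mathbb{R}^d$ with overlaps of measure zero. $\Lambda'=\Lambda-D$ and $\Omega'=K_{\Lambda'}\cap\Gamma$. $\{\Omega_n\}_{n\ge0}$ is a fixed sequence of finite subsets of $\Gamma$ such that: $\Omega_0=\Omega_\Lambda$; $\Omega_i\subsetneq\Omega_{i+1}$ for all $i\ge 0$ and $\bigcup_i\Omega_i=\Gamma$; each $\Omega_i$ is $\Lambda$-admissible and $w_\Lambda(\Omega_{i+1})\cap\Gamma\subset\Omega_i$ for all $i\ge 0$; $\Omega_{n_0}=\Omega'$ for some index $n_0$; and for $i\ge n_0$, $\Omega_i$ is $\Lambda'$-admissible and $w_{\Lambda'}(\Omega_{i+1})\cap\Gamma\subset\Omega_i$. $T_n=[c_{Ai-j}]_{i,j\in\Omega_n}$ acts on row vectors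 $v\in\mathbb{C}^{1\times\Omega_n}$ by $v\mapsto vT_n$, and $P_nY=\{y_k\}_{k\in\Omega_n}$ for $Y\in\ell(\Gamma)$. A Jordan basis for $T_n$ is a basis of $\mathbb{C}^{1\times\Omega_n}$ putting this action into Jordan form; each basis vector $v_i$ belongs to a unique pair $(\lambda,k)$ with $\lambda\in\Delta_n$, $k\ge1$, $v_i\in\operatorname{Ker}(T_n-\lambda I)^k\setminus\operatorname{Ker}(T_n-\lambda I)^{k-1}$, and is then said to be associated to $\lambda$. For $\lambda\ne0$, $Y_{v_i}\in\ell(\Gamma)$ denotes the unique extension of $v_i$ ($P_nY_{v_i}=v_i$) with $Y_{v_i}\in\operatorname{Ker}(L-\lambda I)^k$. *)

theory Defs
  imports
    "HOL-Analysis.Analysis"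
    "HOL-Library.Function_Algebras"
    "Jordan_Normal_Form.Jordan_Normal_Form"
begin

section \<open>Complex vector spaces of complex-valued functions\<close>

definition cscale :: "complex \<Rightarrow> ('a \<Rightarrow> complex) \<Rightarrow> 'a \<Rightarrow> complex" where
  "cscale a f = (\<lambda>x. a * f x)"

global_interpretation cfun: vector_space "cscale :: complex \<Rightarrow> ('a \<Rightarrow> complex) \<Rightarrow> 'a \<Rightarrow> complex"
  by unfold_locales (auto simp: cscale_def fun_eq_iff algebra_simps)

definition is_basis :: "('a \<Rightarrow> complex) set \<Rightarrow> ('a \<Rightarrow> complex) set \<Rightarrow> bool" where
  "is_basis B V \<longleftrightarrow> cfun.independent B \<and> cfun.span B = V"

text \<open>Needed besides \<^term>\<open>cfun.dim\<close>, which is \<open>0\<close> on infinite-dimensional spaces.\<close>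

definition finite_dimensional :: "('a \<Rightarrow> complex) set \<Rightarrow> bool" where
  "finite_dimensional V \<longleftrightarrow> (\<exists>B. finite B \<and> is_basis B V)"

definition space_sum :: "'i set \<Rightarrow> ('i \<Rightarrow> ('a \<Rightarrow> complex) set) \<Rightarrow> ('a \<Rightarrow> complex) set" where
  "space_sum I V = {(\<Sum>i\<in>I. f i) | f. \<forall>i\<in>I. f i \<in> V i}"

definition sum_is_direct :: "'i set \<Rightarrow> ('i \<Rightarrow> ('a \<Rightarrow> complex) set) \<Rightarrow> bool" where
  "sum_is_direct I V \<longleftrightarrow>
    (\<forall>f. (\<forall>i\<in>I. f i \<in> V i) \<and> (\<Sum>i\<in>I. f i) = 0 \<longrightarrow> (\<forall>i\<in>I. f i = 0))"

text \<open>The elements of \<^term>\<open>V\<close> in the kernel of \<open>(F - \<mu>I)\<^sup>k\<close>.\<close>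

definition ker_pow ::
  "('a \<Rightarrow> complex) set \<Rightarrow> (('a \<Rightarrow> complex) \<Rightarrow> 'a \<Rightarrow> complex) \<Rightarrow> complex \<Rightarrow> nat \<Rightarrow> ('a \<Rightarrow> complex) set" where
  "ker_pow V F \<mu> k = {v \<in> V. ((\<lambda>u. F u - cscale \<mu> u) ^^ k) v = 0}"

section \<open>Row vectors and matrices indexed by a set\<close>

text \<open>Families of complex numbers indexed by a set \<open>S\<close> are represented by the functions
  vanishing outside \<open>S\<close>; this covers both \<open>\<ell>(\<Gamma>)\<close> and the row vectors indexed
  by a finite \<open>\<Omega>\<^sub>n\<close>.\<close>

definition seqs :: "'a set \<Rightarrow> ('a \<Rightarrow> complex) set" where
  "seqs S = {y. \<forall>k. k \<notin> S \<longrightarrow> y k = 0}"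

definition restr :: "'a set \<Rightarrow> ('a \<Rightarrow> complex) \<Rightarrow> 'a \<Rightarrow> complex" where
  "restr S y = (\<lambda>k. if k \<in> S then y k else 0)"

text \<open>The product \<open>y M\<close> for a matrix \<open>M\<close> indexed by \<open>S \<times> S\<close>. For infinite \<open>S\<close> it is
  meaningful if every column of \<open>M\<close> has finite support, which the sum is restricted to.\<close>

definition row_mult :: "'a set \<Rightarrow> ('a \<Rightarrow> 'a \<Rightarrow> complex) \<Rightarrow> ('a \<Rightarrow> complex) \<Rightarrow> 'a \<Rightarrow> complex" where
  "row_mult S M y = (\<lambda>j. if j \<in> S then (\<Sum>i | i \<in> S \<and> M i j \<noteq> 0. y i * M i j) else 0)"

text \<open>The matrix \<open>[M i j]\<close>, \<open>i, j \<in> S\<close>, for finite \<open>S\<close>, via the library's enumeration of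
  \<open>S\<close>. It is only used for eigenvalues and the characteristic polynomial, which do not
  depend on the enumeration.\<close>

definition fin_matrix :: "'a set \<Rightarrow> ('a \<Rightarrow> 'a \<Rightarrow> complex) \<Rightarrow> complex mat" where
  "fin_matrix S M = Matrix.mat (card S) (card S) (\<lambda>(a, b). M (from_nat_into S a) (from_nat_into S b))"

text \<open>The coordinates of \<open>v\<^sub>i M\<close> with respect to the basis form row \<open>i\<close> of the Jordan matrix.
  As the order of the basis vectors is existentially quantified, it does not matter
  whether the ones stand above or below the diagonal.\<close>

definition jordan_basis :: "'a set \<Rightarrow> ('a \<Rightarrow> 'a \<Rightarrow> complex) \<Rightarrow> ('a \<Rightarrow> complex) set \<Rightarrow> bool" where
  "jordan_basis S M B \<longleftrightarrow> is_basis B (seqs S) \<and>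
    (\<exists>vs n_as. distinct vs \<and> set vs = B \<and>
      0 \<notin> fst ` set n_as \<and> sum_list (map fst n_as) = length vs \<and>
      (\<forall>i<length vs. row_mult S M (vs ! i) =
        (\<Sum>j<length vs. cscale (jordan_matrix n_as $$ (i, j)) (vs ! j))))"

definition in_level :: "'a set \<Rightarrow> ('a \<Rightarrow> 'a \<Rightarrow> complex) \<Rightarrow> complex \<Rightarrow> nat \<Rightarrow> ('a \<Rightarrow> complex) \<Rightarrow> bool" where
  "in_level S M \<mu> k v \<longleftrightarrow> k \<ge> 1 \<and>
    v \<in> ker_pow (seqs S) (row_mult S M) \<mu> k - ker_pow (seqs S) (row_mult S M) \<mu> (k - 1)"

definition associated :: "'a set \<Rightarrow> ('a \<Rightarrow> 'a \<Rightarrow> complex) \<Rightarrow> complex \<Rightarrow> ('a \<Rightarrow> complex) \<Rightarrow> bool" where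
  "associated S M \<mu> v \<longleftrightarrow> (\<exists>k. in_level S M \<mu> k v)"

text \<open>The sequence \<open>Y\<^sub>v\<close>, for a row vector \<open>v\<close> indexed by \<open>S \<subseteq> \<Gamma>\<close> and associated to \<open>\<mu>\<close>.\<close>

definition extension_seq ::
  "'a set \<Rightarrow> 'a set \<Rightarrow> ('a \<Rightarrow> 'a \<Rightarrow> complex) \<Rightarrow> complex \<Rightarrow> ('a \<Rightarrow> complex) \<Rightarrow> 'a \<Rightarrow> complex" where
  "extension_seq \<Gamma> S M \<mu> v = (THE Y. restr S Y = v \<and>
    (\<exists>k. in_level S M \<mu> k v \<and> Y \<in> ker_pow (seqs \<Gamma>) (row_mult \<Gamma> M) \<mu> k))"

section \<open>Lattices, dilations and admissible sets\<close>

definition is_lattice :: "(real^'d) set \<Rightarrow> bool" where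
  "is_lattice \<Gamma> \<longleftrightarrow>
    (\<exists>M :: real^'d^'d. invertible M \<and> \<Gamma> = (\<lambda>x. M *v x) ` {x. \<forall>i. vec_nth x i \<in> \<int>})"

definition is_dilation :: "(real^'d) set \<Rightarrow> real^'d^'d \<Rightarrow> bool" where
  "is_dilation \<Gamma> A \<longleftrightarrow> (\<lambda>x. A *v x) ` \<Gamma> \<subseteq> \<Gamma> \<and>
    (\<forall>z. (\<exists>v :: complex^'d. v \<noteq> 0 \<and> map_matrix complex_of_real A *v v = z *s v) \<longrightarrow> norm z > 1)"

definition w_map :: "real^'d^'d \<Rightarrow> (real^'d) set \<Rightarrow> (real^'d) set \<Rightarrow> (real^'d) set" where
  "w_map A H B = {matrix_inv A *v (b + h) | b h. b \<in> B \<and> h \<in> H}"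

definition attractor :: "real^'d^'d \<Rightarrow> (real^'d) set \<Rightarrow> (real^'d) set" where
  "attractor A H = (THE K. K \<noteq> {} \<and> compact K \<and> w_map A H K = K)"

definition lattice_attractor :: "(real^'d) set \<Rightarrow> real^'d^'d \<Rightarrow> (real^'d) set \<Rightarrow> (real^'d) set" where
  "lattice_attractor \<Gamma> A H = attractor A H \<inter> \<Gamma>"

definition admissible :: "(real^'d) set \<Rightarrow> real^'d^'d \<Rightarrow> (real^'d) set \<Rightarrow> (real^'d) set \<Rightarrow> bool" where
  "admissible \<Gamma> A H \<Omega> \<longleftrightarrow> \<Omega> \<subseteq> \<Gamma> \<and> w_map A H \<Omega> \<inter> \<Gamma> \<subseteq> \<Omega>"

definition tiling_digits :: "(real^'d) set \<Rightarrow> real^'d^'d \<Rightarrow> (real^'d) set \<Rightarrow> bool" where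
  "tiling_digits \<Gamma> A D \<longleftrightarrow> D \<subseteq> \<Gamma> \<and> 0 \<in> D \<and>
    (\<forall>g\<in>\<Gamma>. \<exists>!d. d \<in> D \<and> g - d \<in> (\<lambda>x. A *v x) ` \<Gamma>) \<and>
    (\<Union>k\<in>\<Gamma>. (\<lambda>x. x + k) ` attractor A D) = UNIV \<and>
    (\<forall>k\<in>\<Gamma>. \<forall>l\<in>\<Gamma>. k \<noteq> l \<longrightarrow>
      (\<lambda>x. x + k) ` attractor A D \<inter> (\<lambda>x. x + l) ` attractor A D \<in> null_sets lebesgue)"

section \<open>Refinable functions\<close>

definition compactly_supported :: "(real^'d \<Rightarrow> complex) \<Rightarrow> bool" where
  "compactly_supported f \<longleftrightarrow> compact (closure {x. f x \<noteq> 0})"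

text \<open>The entries of the matrices \<open>L\<close> and \<open>T\<^sub>n\<close>.\<close>

definition refine_entry :: "real^'d^'d \<Rightarrow> (real^'d \<Rightarrow> complex) \<Rightarrow> real^'d \<Rightarrow> real^'d \<Rightarrow> complex" where
  "refine_entry A c i j = c (A *v i - j)"

text \<open>The function \<open>Y\<Phi>\<close>. The sum is restricted to its nonzero terms, of which there are
  finitely many for compactly supported \<open>\<phi>\<close>.\<close>

definition combine ::
  "(real^'d) set \<Rightarrow> (real^'d \<Rightarrow> complex) \<Rightarrow> (real^'d \<Rightarrow> complex) \<Rightarrow> real^'d \<Rightarrow> complex" where
  "combine \<Gamma> \<phi> Y = (\<lambda>x. \<Sum>k | k \<in> \<Gamma> \<and> \<phi> (x + k) \<noteq> 0. Y k * \<phi> (x + k))"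

definition translate_space :: "(real^'d) set \<Rightarrow> (real^'d \<Rightarrow> complex) \<Rightarrow> (real^'d \<Rightarrow> complex) set" where
  "translate_space \<Gamma> \<phi> = combine \<Gamma> \<phi> ` seqs \<Gamma>"

definition translates_independent :: "(real^'d) set \<Rightarrow> (real^'d \<Rightarrow> complex) \<Rightarrow> bool" where
  "translates_independent \<Gamma> \<phi> \<longleftrightarrow>
    (\<forall>\<alpha>\<in>seqs \<Gamma>. (\<forall>x. (\<Sum>k | k \<in> \<Gamma> \<and> \<phi> (x - k) \<noteq> 0. \<alpha> k * \<phi> (x - k)) = 0)
      \<longrightarrow> (\<forall>k\<in>\<Gamma>. \<alpha> k = 0))"

text \<open>Here \<open>A\<^bsup>k-r\<^esup>\<close> with \<open>k \<le> r\<close> is the power \<open>r - k\<close> of the inverse of \<open>A\<close>.\<close>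

definition homogeneous_class :: "real^'d^'d \<Rightarrow> complex \<Rightarrow> nat \<Rightarrow> (real^'d \<Rightarrow> complex) set" where
  "homogeneous_class A \<mu> r = {h. \<forall>x.
    (\<Sum>k=0..r. of_nat (r choose k) * (- \<mu>) ^ k * h (((\<lambda>y. matrix_inv A *v y) ^^ (r - k)) x)) = 0}"

definition homogeneous_space ::
  "(real^'d) set \<Rightarrow> real^'d^'d \<Rightarrow> (real^'d \<Rightarrow> complex) \<Rightarrow> complex \<Rightarrow> (real^'d \<Rightarrow> complex) set" where
  "homogeneous_space \<Gamma> A \<phi> \<mu> =
    {h \<in> translate_space \<Gamma> \<phi>. \<exists>k\<ge>1. h \<in> homogeneous_class A \<mu> k}"

end

theory Submission
  imports Defs
begin

text \<open>Write \<open>L\<close> for the action \<open>Y \<mapsto> Y L\<close> on sequences, \<open>T\<close> for the action of \<open>T\<^sub>n\<close> on row vectors and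
  \<open>D\<close> for the dilation \<open>h \<mapsto> h \<circ> A\<^sup>-\<^sup>1\<close>.

  The refinement equation says that \<open>Y \<mapsto> Y\<Phi>\<close> intertwines \<open>L\<close> with \<open>D\<close> (\<open>combine_row_mult\<close>), and
  the homogeneity condition says that \<open>h\<close> is annihilated by a power of \<open>D - \<mu>I\<close>
  (\<open>homogeneous_class_iff\<close>). If the translates are linearly independent, then \<open>Y \<mapsto> Y\<Phi>\<close> is
  injective, so that the homogeneous functions in question are exactly the images of the
  generalised eigenvectors of \<open>L\<close> (\<open>gen_eig_intertwine\<close>).

  It remains to compare \<open>L\<close> with its finite section \<open>T\<close>. Admissibility means that the restriction
  of \<open>Y L\<close> to \<open>\<Omega>\<^sub>n\<close> is the restriction of \<open>Y\<close> multiplied by \<open>T\<^sub>n\<close>, and, more strongly, that \<open>Y L\<close> on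
  \<open>\<Omega>\<^sub>i\<^sub>+\<^sub>1\<close> depends only on \<open>Y\<close> on \<open>\<Omega>\<^sub>i\<close>. Hence on the sequences vanishing on \<open>\<Omega>\<^sub>n\<close> the operator \<open>L\<close> is
  locally nilpotent, and \<open>L - \<mu>I\<close> is invertible there for \<open>\<mu> \<noteq> 0\<close> (\<open>restr_gen_eig_eq_0\<close>,
  \<open>shift_op_surj\<close>). So restriction to \<open>\<Omega>\<^sub>n\<close> is an isomorphism from the generalised eigenspace of \<open>L\<close> to
  that of \<open>T\<close>, with the extension \<open>v \<mapsto> Y\<^sub>v\<close> as its inverse.

  Finally, the vectors of a Jordan basis associated to \<open>\<mu>\<close> form a basis of the generalised eigenspace
  of \<open>T\<close>, and their number is the multiplicity of \<open>\<mu>\<close> in the characteristic polynomial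
  (\<open>jordan_basis_gen_eig\<close>, \<open>is_basis_gen_eig\<close>). Bases for different \<open>\<mu>\<close> are put together using that
  generalised eigenspaces are independent (\<open>gen_eig_direct\<close>, \<open>is_basis_space_sum\<close>).\<close>

section \<open>Linear operators on spaces of functions\<close>

abbreviation lin :: "(('a \<Rightarrow> complex) \<Rightarrow> ('b \<Rightarrow> complex)) \<Rightarrow> bool" where
  "lin F \<equiv> Vector_Spaces.linear cscale cscale F"

global_interpretation fpair: vector_space_pair
  "cscale :: complex \<Rightarrow> ('a \<Rightarrow> complex) \<Rightarrow> 'a \<Rightarrow> complex"
  "cscale :: complex \<Rightarrow> ('b \<Rightarrow> complex) \<Rightarrow> 'b \<Rightarrow> complex"
  by unfold_locales

lemma linI:
  assumes "\<And>x y. F (x + y) = F x + F y" "\<And>a x. F (cscale a x) = cscale a (F x)"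
  shows "lin F"
  unfolding Vector_Spaces.linear_iff using assms by (intro conjI allI cfun.vector_space_axioms)

lemma linD:
  assumes "lin F"
  shows "F (x + y) = F x + F y" "F (cscale a x) = cscale a (F x)" "F 0 = 0"
    "F (x - y) = F x - F y" "F (sum g I) = (\<Sum>i\<in>I. F (g i))"
proof -
  interpret Vector_Spaces.linear cscale cscale F by fact
  show "F (x + y) = F x + F y" "F (cscale a x) = cscale a (F x)" "F 0 = 0"
    "F (x - y) = F x - F y" "F (sum g I) = (\<Sum>i\<in>I. F (g i))"
    by (rule add scale zero diff sum)+
qed

lemma sum_fun_apply: "(\<Sum>i\<in>I. f i) x = (\<Sum>i\<in>I. f i x)"
  for f :: "'i \<Rightarrow> 'a \<Rightarrow> 'b::comm_monoid_add"
  by (induction I rule: infinite_finite_induct) auto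

lemma subspace_seqs: "cfun.subspace (seqs S)"
  by (auto simp: cfun.subspace_def seqs_def cscale_def)

lemma lin_restr: "lin (restr S)"
  by (rule linI) (auto simp: restr_def cscale_def)

lemma lin_row_mult: "lin (row_mult S M)"
  by (rule linI)
    (auto simp: row_mult_def cscale_def fun_eq_iff algebra_simps sum.distrib sum_distrib_left)

lemma lin_combine: "lin (combine \<Gamma> \<phi>)"
  by (rule linI)
    (auto simp: combine_def cscale_def fun_eq_iff algebra_simps sum.distrib sum_distrib_left)

text \<open>Applying \<open>P\<close> turns a linear relation between the \<open>Y b\<close> into one between the \<open>b\<close>, and
  identifies an element of \<open>V\<close> with the combination of the \<open>Y b\<close> having the same image. Below,
  \<open>P\<close> is the restriction of sequences to a finite set and \<open>Y\<close> the extension of row vectors.\<close>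

lemma is_basis_lift:
  assumes P: "lin P" and V: "cfun.subspace V" and fin: "finite B" and inj: "inj_on P V"
    and Y: "\<And>b. b \<in> B \<Longrightarrow> Y b \<in> V \<and> P (Y b) = b"
    and B: "cfun.independent B" and span: "P ` V \<subseteq> cfun.span B"
  shows "inj_on Y B" "is_basis (Y ` B) V"
proof -
  show injY: "inj_on Y B"
    by (metis Y inj_onI)
  have PY: "P ` Y ` B = B"
    using Y by force
  have sub: "cfun.span (Y ` B) \<subseteq> V"
    using Y by (intro cfun.span_minimal V) auto
  have "cfun.independent (Y ` B)"
  proof (subst cfun.dependent_finite, use fin in simp, clarify)
    fix u b assume 0: "(\<Sum>y\<in>Y ` B. cscale (u y) y) = 0" and b: "b \<in> B" "u (Y b) \<noteq> 0"
    have "(\<Sum>b\<in>B. cscale (u (Y b)) (Y b)) = 0"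
      using 0 by (simp add: sum.reindex[OF injY])
    then have "P (\<Sum>b\<in>B. cscale (u (Y b)) (Y b)) = 0"
      using linD(3)[OF P] by simp
    then have "(\<Sum>b\<in>B. cscale (u (Y b)) b) = 0"
      using Y by (simp add: linD(2,5)[OF P])
    then show False
      using B b cfun.dependent_finite[OF fin] by auto
  qed
  moreover have "V \<subseteq> cfun.span (Y ` B)"
  proof
    fix v assume v: "v \<in> V"
    then have "P v \<in> cfun.span (P ` Y ` B)"
      using span PY by auto
    then obtain w where w: "w \<in> cfun.span (Y ` B)" "P v = P w"
      using fpair.linear_span_image[OF P] by blast
    then have "v = w"
      using inj v sub by (meson inj_onD subsetD)
    then show "v \<in> cfun.span (Y ` B)"
      using w by simp
  qed
  ultimately show "is_basis (Y ` B) V"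
    using sub by (auto simp: is_basis_def)
qed

lemma is_basis_image:
  assumes "lin C" "is_basis B V" "inj_on C V"
  shows "is_basis (C ` B) (C ` V)"
  using assms fpair.linear_independent_injective_image[OF assms(1)]
    fpair.linear_span_image[OF assms(1)] by (simp add: is_basis_def)

lemma finite_basis_dim:
  assumes "finite B" "is_basis B V"
  shows "finite_dimensional V" "cfun.dim V = card B"
  using assms cfun.dim_span_eq_card_independent by (auto simp: finite_dimensional_def is_basis_def)

lemma in_span_finite_iff:
  assumes "finite B"
  shows "v \<in> cfun.span B \<longleftrightarrow> (\<exists>u. v = (\<Sum>b\<in>B. cscale (u b) b))"
  using assms by (auto simp: cfun.span_finite)

text \<open>As the sum is direct, the bases are disjoint and a linear relation between vectors of their
  union splits into one relation for each summand.\<close>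

lemma is_basis_space_sum:
  assumes fin: "finite I" and finB: "\<And>i. i \<in> I \<Longrightarrow> finite (B i)"
    and basis: "\<And>i. i \<in> I \<Longrightarrow> is_basis (B i) (V i)"
    and dir: "sum_is_direct I V"
  shows "is_basis (\<Union>i\<in>I. B i) (space_sum I V)" "card (\<Union>i\<in>I. B i) = (\<Sum>i\<in>I. card (B i))"
proof -
  have sub: "cfun.subspace (V i)" if "i \<in> I" for i
    using basis[OF that] cfun.subspace_span by (metis is_basis_def)
  have BV: "B i \<subseteq> V i" if "i \<in> I" for i
    using basis[OF that] cfun.span_superset by (auto simp: is_basis_def)
  have dirD: "f i = 0" if "\<forall>i\<in>I. f i \<in> V i" "(\<Sum>i\<in>I. f i) = 0" "i \<in> I" for f i
    using dir[unfolded sum_is_direct_def, rule_format, of f i] that by simp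
  have combV: "(\<Sum>b\<in>B i. cscale (u b) b) \<in> V i" if "i \<in> I" for u i
    using BV[OF that]
    by (intro cfun.subspace_sum[OF sub[OF that]] cfun.subspace_scale[OF sub[OF that]]) auto
  have disj: "B i \<inter> B j = {}" if ij: "i \<in> I" "j \<in> I" "i \<noteq> j" for i j
  proof (rule ccontr)
    assume "B i \<inter> B j \<noteq> {}"
    then obtain b where b: "b \<in> B i" "b \<in> B j" by auto
    \<comment> \<open>A common basis vector would give the relation \<open>b + (- b) = 0\<close> between two summands.\<close>
    define f where "f = (\<lambda>k. if k = i then b else if k = j then - b else 0)"
    have "\<forall>k\<in>I. f k \<in> V k"
    proof
      fix k assume k: "k \<in> I"
      show "f k \<in> V k"
        using b BV[OF k] cfun.subspace_0[OF sub[OF k]] cfun.subspace_neg[OF sub[OF k]]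
        by (auto simp: f_def)
    qed
    moreover have "(\<Sum>k\<in>I. f k) = 0"
    proof -
      have "(\<Sum>k\<in>I. f k) = (\<Sum>k\<in>{i, j}. f k)"
        using ij by (intro sum.mono_neutral_right fin) (auto simp: f_def)
      then show ?thesis using ij by (simp add: f_def)
    qed
    ultimately have "f i = 0"
      using dirD ij(1) by blast
    then show False
      using b basis[OF ij(1)] cfun.dependent_zero by (auto simp: f_def is_basis_def)
  qed
  show "card (\<Union>i\<in>I. B i) = (\<Sum>i\<in>I. card (B i))"
    using disj finB fin by (intro card_UN_disjoint) auto
  have split: "(\<Sum>b\<in>(\<Union>i\<in>I. B i). g b) = (\<Sum>i\<in>I. \<Sum>b\<in>B i. g b)"
    for g :: "('b \<Rightarrow> complex) \<Rightarrow> 'b \<Rightarrow> complex"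
    using disj finB fin by (intro sum.UNION_disjoint) auto
  have finU: "finite (\<Union>i\<in>I. B i)"
    using fin finB by auto
  have "cfun.independent (\<Union>i\<in>I. B i)"
  proof (subst cfun.dependent_finite[OF finU], clarify)
    fix u i b
    assume 0: "(\<Sum>b\<in>(\<Union>i\<in>I. B i). cscale (u b) b) = 0" and b: "i \<in> I" "b \<in> B i" "u b \<noteq> 0"
    have "(\<Sum>b\<in>B i. cscale (u b) b) = 0"
      by (rule dirD) (use combV 0 b(1) in \<open>simp_all add: split\<close>)
    then show False
      using basis[OF b(1)] finB[OF b(1)] b by (auto simp: is_basis_def cfun.dependent_finite)
  qed
  moreover have "cfun.span (\<Union>i\<in>I. B i) = space_sum I V"
  proof
    show "cfun.span (\<Union>i\<in>I. B i) \<subseteq> space_sum I V"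
    proof
      fix v assume "v \<in> cfun.span (\<Union>i\<in>I. B i)"
      then obtain u where u: "v = (\<Sum>i\<in>I. \<Sum>b\<in>B i. cscale (u b) b)"
        by (auto simp: in_span_finite_iff[OF finU] split)
      then show "v \<in> space_sum I V"
        using combV
        by (auto simp: space_sum_def intro!: exI[of _ "\<lambda>i. \<Sum>b\<in>B i. cscale (u b) b"])
    qed
    show "space_sum I V \<subseteq> cfun.span (\<Union>i\<in>I. B i)"
    proof
      fix v assume "v \<in> space_sum I V"
      then obtain f where f: "v = (\<Sum>i\<in>I. f i)" "\<forall>i\<in>I. f i \<in> V i"
        by (auto simp: space_sum_def)
      have "f i \<in> cfun.span (\<Union>i\<in>I. B i)" if "i \<in> I" for i
        using f(2) basis[OF that] that cfun.span_mono[of "B i" "\<Union>i\<in>I. B i"]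
        by (auto simp: is_basis_def)
      then show "v \<in> cfun.span (\<Union>i\<in>I. B i)"
        unfolding f(1) by (rule cfun.span_sum)
    qed
  qed
  ultimately show "is_basis (\<Union>i\<in>I. B i) (space_sum I V)"
    by (simp add: is_basis_def)
qed

section \<open>Generalised eigenspaces\<close>

definition shift_op ::
  "(('a \<Rightarrow> complex) \<Rightarrow> 'a \<Rightarrow> complex) \<Rightarrow> complex \<Rightarrow> ('a \<Rightarrow> complex) \<Rightarrow> 'a \<Rightarrow> complex" where
  "shift_op F \<mu> = (\<lambda>u. F u - cscale \<mu> u)"

definition gen_eig ::
  "('a \<Rightarrow> complex) set \<Rightarrow> (('a \<Rightarrow> complex) \<Rightarrow> 'a \<Rightarrow> complex) \<Rightarrow> complex \<Rightarrow> ('a \<Rightarrow> complex) set" where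
  "gen_eig V F \<mu> = (\<Union>k. ker_pow V F \<mu> k)"

lemma ker_pow_iff: "v \<in> ker_pow V F \<mu> k \<longleftrightarrow> v \<in> V \<and> (shift_op F \<mu> ^^ k) v = 0"
  by (simp add: ker_pow_def shift_op_def)

lemma gen_eig_iff: "v \<in> gen_eig V F \<mu> \<longleftrightarrow> v \<in> V \<and> (\<exists>k. (shift_op F \<mu> ^^ k) v = 0)"
  by (auto simp: gen_eig_def ker_pow_iff)

lemma lin_shift_op:
  assumes "lin F"
  shows "lin (shift_op F \<mu>)"
  using linD(1,2)[OF assms] by (intro linI) (auto simp: shift_op_def cscale_def fun_eq_iff algebra_simps)

lemma lin_funpow:
  fixes F :: "('a \<Rightarrow> complex) \<Rightarrow> 'a \<Rightarrow> complex"
  assumes "lin F"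
  shows "lin (F ^^ k)"
proof (induction k)
  case 0
  show ?case by (rule linI) (simp_all add: fun_eq_iff)
next
  case (Suc k)
  show ?case
    by (intro linI) (simp_all only: funpow.simps comp_apply linD(1,2)[OF assms] linD(1,2)[OF Suc])
qed

lemma shift_op_pow_mono:
  assumes "lin F" "(shift_op F \<mu> ^^ k) v = 0" "k \<le> l"
  shows "(shift_op F \<mu> ^^ l) v = 0"
proof -
  have "(shift_op F \<mu> ^^ l) v = (shift_op F \<mu> ^^ (l - k)) ((shift_op F \<mu> ^^ k) v)"
    using assms(3) by (metis comp_apply funpow_add le_add_diff_inverse2)
  then show ?thesis
    using assms(2) linD(3)[OF lin_funpow[OF lin_shift_op[OF assms(1)]]] by metis
qed

lemma subspace_gen_eig:
  assumes F: "lin F" and V: "cfun.subspace V"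
  shows "cfun.subspace (gen_eig V F \<mu>)"
proof -
  note P = linD[OF lin_funpow[OF lin_shift_op[OF F]]]
  have "x + y \<in> gen_eig V F \<mu>" if xy: "x \<in> gen_eig V F \<mu>" "y \<in> gen_eig V F \<mu>" for x y
  proof -
    obtain k l where "(shift_op F \<mu> ^^ k) x = 0" "(shift_op F \<mu> ^^ l) y = 0"
      using xy by (auto simp: gen_eig_iff)
    then have "(shift_op F \<mu> ^^ max k l) (x + y) = 0"
      using shift_op_pow_mono[OF F] by (subst P(1)) simp
    then show ?thesis
      using xy cfun.subspace_add[OF V] by (auto simp: gen_eig_iff)
  qed
  moreover have "0 \<in> gen_eig V F \<mu>"
    using cfun.subspace_0[OF V] P(3) by (auto simp: gen_eig_iff)
  moreover have "cscale a x \<in> gen_eig V F \<mu>" if x: "x \<in> gen_eig V F \<mu>" for a x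
  proof -
    obtain k where "(shift_op F \<mu> ^^ k) x = 0"
      using x by (auto simp: gen_eig_iff)
    then have "(shift_op F \<mu> ^^ k) (cscale a x) = 0"
      using P(2) by simp
    then show ?thesis
      using x cfun.subspace_scale[OF V] by (auto simp: gen_eig_iff)
  qed
  ultimately show ?thesis
    by (simp add: cfun.subspace_def)
qed

lemma shift_op_commute:
  assumes "lin F"
  shows "shift_op F \<mu> (shift_op F \<nu> u) = shift_op F \<nu> (shift_op F \<mu> u)"
  unfolding shift_op_def linD(2,4)[OF assms] by (simp add: cscale_def fun_eq_iff algebra_simps)

lemma shift_op_pow_commute:
  assumes "lin F"
  shows "shift_op F \<mu> ((shift_op F \<nu> ^^ k) u) = (shift_op F \<nu> ^^ k) (shift_op F \<mu> u)"
  by (induction k) (simp_all add: shift_op_commute[OF assms, of \<mu> \<nu>])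

text \<open>On an eigenvector to \<open>\<nu>\<close> the operator \<open>(F - \<mu>I)\<^sup>k\<close> acts as the nonzero scalar
  \<open>(\<nu> - \<mu>)\<^sup>k\<close>; the general case follows by applying \<open>F - \<nu>I\<close>.\<close>

lemma gen_eig_disjoint:
  assumes F: "lin F" and "\<mu> \<noteq> \<nu>"
  shows "(shift_op F \<mu> ^^ k) u = 0 \<Longrightarrow> (shift_op F \<nu> ^^ l) u = 0 \<Longrightarrow> u = 0"
proof (induction l arbitrary: u)
  case (Suc l)
  have "(shift_op F \<mu> ^^ k) (shift_op F \<nu> u) = 0"
    using Suc.prems(1) shift_op_pow_commute[OF F, where \<mu> = \<nu> and \<nu> = \<mu> and k = k and u = u] linD(3)[OF lin_shift_op[OF F]]
    by metis
  moreover have "(shift_op F \<nu> ^^ l) (shift_op F \<nu> u) = 0"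
    using Suc.prems(2) by (metis funpow_swap1 funpow.simps(2) comp_apply)
  ultimately have "shift_op F \<nu> u = 0"
    by (rule Suc.IH)
  then have ev: "F u = cscale \<nu> u" by (simp add: shift_op_def)
  have "(shift_op F \<mu> ^^ j) u = cscale ((\<nu> - \<mu>) ^ j) u" for j
    by (induction j) (simp_all add: shift_op_def linD(2)[OF F] ev,
        simp_all add: cscale_def fun_eq_iff algebra_simps)
  then have "cscale ((\<nu> - \<mu>) ^ k) u = 0"
    using Suc.prems(1) by metis
  then show ?case
    using assms(2) by simp
qed simp

text \<open>A power of \<open>F - \<mu>I\<close> kills the component to \<open>\<mu>\<close> and maps every other generalised
  eigenspace injectively into itself, which allows induction on the number of summands.\<close>

lemma gen_eig_direct:
  assumes F: "lin F" and "finite I"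
  shows "\<forall>\<mu>\<in>I. f \<mu> \<in> gen_eig V F \<mu> \<Longrightarrow> (\<Sum>\<mu>\<in>I. f \<mu>) = 0 \<Longrightarrow> \<forall>\<mu>\<in>I. f \<mu> = 0"
  using assms(2)
proof (induction I arbitrary: f V rule: finite_induct)
  case (insert \<mu> I)
  note P = linD[OF lin_funpow[OF lin_shift_op[OF F]]]
  obtain k where k: "(shift_op F \<mu> ^^ k) (f \<mu>) = 0"
    using insert.prems(1) by (auto simp: gen_eig_iff)
  define g where "g \<nu> = (shift_op F \<mu> ^^ k) (f \<nu>)" for \<nu>
  have comm: "(shift_op F \<nu> ^^ l) ((shift_op F \<mu> ^^ k) v) = (shift_op F \<mu> ^^ k) ((shift_op F \<nu> ^^ l) v)"
    for \<nu> l v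
    by (induction l) (simp_all add: shift_op_pow_commute[OF F])
  have "g \<nu> \<in> gen_eig UNIV F \<nu>" if \<nu>: "\<nu> \<in> I" for \<nu>
  proof -
    obtain l where "(shift_op F \<nu> ^^ l) (f \<nu>) = 0"
      using insert.prems(1) \<nu> by (auto simp: gen_eig_iff)
    then have "(shift_op F \<nu> ^^ l) (g \<nu>) = 0"
      unfolding g_def comm using P(3) by simp
    then show ?thesis by (auto simp: gen_eig_iff)
  qed
  moreover have "(\<Sum>\<nu>\<in>I. g \<nu>) = 0"
  proof -
    have "(shift_op F \<mu> ^^ k) (f \<mu> + (\<Sum>\<nu>\<in>I. f \<nu>)) = 0"
      using insert.prems(2) insert.hyps by (metis P(3) sum.insert)
    then show ?thesis
      unfolding P(1) P(5) k g_def by simp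
  qed
  ultimately have g0: "\<forall>\<nu>\<in>I. g \<nu> = 0"
    using insert.IH[of g UNIV] by blast
  have "f \<nu> = 0" if \<nu>: "\<nu> \<in> I" for \<nu>
  proof -
    obtain l where "(shift_op F \<nu> ^^ l) (f \<nu>) = 0"
      using insert.prems(1) \<nu> by (auto simp: gen_eig_iff)
    moreover have "\<mu> \<noteq> \<nu>" using \<nu> insert.hyps by auto
    ultimately show ?thesis
      using gen_eig_disjoint[OF F] g0 \<nu> unfolding g_def by metis
  qed
  then show ?case
    using insert.prems(2) insert.hyps by (simp add: zero_fun_def)
qed simp

text \<open>Grouping the basis expansion of \<open>v\<close> by eigenvalue decomposes \<open>v\<close> into generalised
  eigenvectors; as the sum of the eigenspaces is direct, only the component to \<open>\<mu>\<close> survives.\<close>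

lemma is_basis_gen_eig:
  assumes F: "lin F" and B: "is_basis B V" "finite B"
    and \<alpha>: "\<And>b. b \<in> B \<Longrightarrow> b \<in> gen_eig V F (\<alpha> b)"
  shows "is_basis {b \<in> B. \<alpha> b = \<mu>} (gen_eig V F \<mu>)"
proof -
  have V: "cfun.subspace V" using B(1) cfun.subspace_span by (metis is_basis_def)
  note sub = subspace_gen_eig[OF F V]
  have "cfun.independent {b \<in> B. \<alpha> b = \<mu>}"
    using B(1) cfun.independent_mono[of B] by (auto simp: is_basis_def)
  moreover have "cfun.span {b \<in> B. \<alpha> b = \<mu>} \<subseteq> gen_eig V F \<mu>"
    using \<alpha> by (intro cfun.span_minimal sub) auto
  moreover have "v \<in> cfun.span {b \<in> B. \<alpha> b = \<mu>}" if v: "v \<in> gen_eig V F \<mu>" for v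
  proof -
    have "v \<in> cfun.span B" using v B(1) by (auto simp: gen_eig_iff is_basis_def)
    then obtain u where u: "v = (\<Sum>b\<in>B. cscale (u b) b)"
      by (auto simp: in_span_finite_iff[OF B(2)])
    define f where "f \<nu> = (\<Sum>b | b \<in> B \<and> \<alpha> b = \<nu>. cscale (u b) b)" for \<nu>
    define g where "g \<nu> = f \<nu> - (if \<nu> = \<mu> then v else 0)" for \<nu>
    define I where "I = insert \<mu> (\<alpha> ` B)"
    have I: "finite I" "\<mu> \<in> I" using B(2) by (auto simp: I_def)
    have f: "f \<nu> \<in> gen_eig V F \<nu>" for \<nu>
      unfolding f_def using \<alpha> by (intro cfun.subspace_sum[OF sub] cfun.subspace_scale[OF sub]) auto
    have "\<forall>\<nu>\<in>I. g \<nu> \<in> gen_eig V F \<nu>"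
      using f v cfun.subspace_diff[OF sub] by (auto simp: g_def)
    moreover have "(\<Sum>\<nu>\<in>I. g \<nu>) = 0"
    proof -
      have "(\<Sum>\<nu>\<in>I. f \<nu>) = v"
        unfolding f_def u using B(2) I by (intro sum.group) (auto simp: I_def)
      then show ?thesis
        using I by (simp add: g_def sum_subtractf)
    qed
    ultimately have "g \<mu> = 0"
      using gen_eig_direct[OF F I(1)] I(2) by blast
    then have "v = f \<mu>" by (simp add: g_def)
    then show ?thesis
      unfolding \<open>v = f \<mu>\<close> f_def by (intro cfun.span_sum cfun.span_scale cfun.span_base) auto
  qed
  ultimately show ?thesis
    by (auto simp: is_basis_def)
qed

section \<open>Jordan bases\<close>

text \<open>All that is needed of the Jordan form: a nonzero entry off the diagonal stands just to the
  right of the diagonal and inside one block. So \<open>T - aI\<close> maps the basis vector number \<open>i\<close>, where \<open>a\<close> is its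
  diagonal entry, to a multiple of the next one, and only to a nonzero one if the diagonal entry
  there is \<open>a\<close> as well.\<close>

lemma jordan_matrix_off_diag:
  assumes "i < sum_list (map fst n_as)" "j < sum_list (map fst n_as)" "i \<noteq> j"
    "jordan_matrix n_as $$ (i, j) \<noteq> (0 :: complex)"
  shows "j = Suc i \<and> jordan_matrix n_as $$ (i, i) = jordan_matrix n_as $$ (j, j)"
  using assms
proof (induction n_as arbitrary: i j)
  case (Cons na n_as)
  obtain n a where na: "na = (n, a)" by force
  let ?N = "sum_list (map fst n_as)" and ?J = "jordan_matrix n_as"
  have J: "jordan_matrix (na # n_as) = four_block_mat (jordan_block n a) (0\<^sub>m n ?N) (0\<^sub>m ?N n) ?J"
    using jordan_matrix_dim[of n_as] by (simp add: na jordan_matrix_def Let_def)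
  have entry: "jordan_matrix (na # n_as) $$ (k, l) =
      (if k < n then if l < n then jordan_block n a $$ (k, l) else 0
       else if l < n then 0 else ?J $$ (k - n, l - n))" if "k < n + ?N" "l < n + ?N" for k l
    using that unfolding J by (auto simp: four_block_mat_def Let_def)
  have bounds: "i < n + ?N" "j < n + ?N" using Cons.prems by (auto simp: na)
  show ?case
  proof (cases "i < n")
    case True
    then show ?thesis
      using Cons.prems(3,4) bounds by (auto simp: entry split: if_splits)
  next
    case False
    then have "\<not> j < n" "?J $$ (i - n, j - n) \<noteq> 0"
      using Cons.prems(4) bounds by (auto simp: entry split: if_splits)
    moreover from this have "j - n = Suc (i - n) \<and> ?J $$ (i - n, i - n) = ?J $$ (j - n, j - n)"
      using Cons.prems(3) bounds False by (intro Cons.IH) auto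
    ultimately show ?thesis
      using bounds False by (auto simp: entry)
  qed
qed simp

lemma order_linear_factors:
  fixes \<mu> :: complex
  shows "order \<mu> (\<Prod>a\<leftarrow>as. [:- a, 1:]) = count_list as \<mu>"
  by (subst order_prod_list) (auto simp: o_def order_linear', induction as, auto)

definition unit_row :: "'a \<Rightarrow> 'a \<Rightarrow> complex" where
  "unit_row s = (\<lambda>k. if k = s then 1 else 0)"

lemma seqs_expand:
  assumes "finite S" "v \<in> seqs S"
  shows "v = (\<Sum>s\<in>S. cscale (v s) (unit_row s))"
proof
  fix k
  have "(\<Sum>s\<in>S. cscale (v s) (unit_row s) k) = (\<Sum>s\<in>S. if s = k then v s else 0)"
    by (intro sum.cong) (auto simp: cscale_def unit_row_def)
  also have "\<dots> = v k"
    using assms by (simp add: seqs_def)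
  finally show "v k = (\<Sum>s\<in>S. cscale (v s) (unit_row s)) k"
    by (simp add: sum_fun_apply)
qed

lemma is_basis_unit_rows:
  assumes "finite S"
  shows "is_basis (unit_row ` S) (seqs S)" "card (unit_row ` S) = card S"
proof -
  have inj: "inj_on unit_row S"
    by (auto simp: inj_on_def unit_row_def fun_eq_iff split: if_splits)
  then show "card (unit_row ` S) = card S"
    by (rule card_image)
  have unit: "unit_row s \<in> seqs S" if "s \<in> S" for s :: 'a
    using that by (auto simp: seqs_def unit_row_def)
  have "cfun.independent (unit_row ` S)"
  proof (subst cfun.dependent_finite, use assms in simp, clarify)
    fix u s assume 0: "(\<Sum>v\<in>unit_row ` S. cscale (u v) v) = 0" and s: "s \<in> S" "u (unit_row s) \<noteq> 0"
    have "(\<Sum>t\<in>S. cscale (u (unit_row t)) (unit_row t)) = 0"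
      using 0 by (simp add: sum.reindex[OF inj])
    then have "0 = (\<Sum>t\<in>S. cscale (u (unit_row t)) (unit_row t) s)"
      by (metis sum_fun_apply zero_fun_def)
    also have "\<dots> = (\<Sum>t\<in>S. if t = s then u (unit_row t) else 0)"
      by (intro sum.cong) (auto simp: cscale_def unit_row_def)
    also have "\<dots> = u (unit_row s)"
      using assms s by simp
    finally show False using s by simp
  qed
  moreover have "cfun.span (unit_row ` S) = seqs S"
  proof
    show "cfun.span (unit_row ` S) \<subseteq> seqs S"
      using unit by (intro cfun.span_minimal subspace_seqs) auto
    show "seqs S \<subseteq> cfun.span (unit_row ` S)"
    proof
      fix v :: "'a \<Rightarrow> complex" assume "v \<in> seqs S"
      then have "v = (\<Sum>s\<in>S. cscale (v s) (unit_row s))"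
        using assms by (intro seqs_expand)
      also have "\<dots> \<in> cfun.span (unit_row ` S)"
        by (intro cfun.span_sum cfun.span_scale cfun.span_base) auto
      finally show "v \<in> cfun.span (unit_row ` S)" .
    qed
  qed
  ultimately show "is_basis (unit_row ` S) (seqs S)"
    by (simp add: is_basis_def)
qed

lemma card_basis_seqs:
  assumes "finite S" "is_basis B (seqs S)"
  shows "card B = card S"
  using assms is_basis_unit_rows[OF assms(1)] cfun.dim_span_eq_card_independent
  unfolding is_basis_def by metis

lemma row_mult_in_seqs: "row_mult S M y \<in> seqs S"
  by (simp add: row_mult_def seqs_def)

lemma row_mult_finite:
  assumes "finite S" "j \<in> S"
  shows "row_mult S M y j = (\<Sum>i\<in>S. y i * M i j)"
  unfolding row_mult_def using assms by (auto intro!: sum.mono_neutral_left)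

text \<open>Writing the basis vectors as the rows of a matrix \<open>P\<close> turns the basis expansion of their
  images into \<open>P M = J P\<close>; an inverse of \<open>P\<close> has the coordinates of the unit vectors as its
  rows.\<close>

lemma char_poly_basis_change:
  assumes S: "finite S" and basis: "is_basis (set vs) (seqs S)" and dist: "distinct vs"
    and J: "J \<in> carrier_mat (length vs) (length vs)"
    and rows: "\<And>i. i < length vs \<Longrightarrow>
      row_mult S M (vs ! i) = (\<Sum>j<length vs. cscale (J $$ (i, j)) (vs ! j))"
  shows "char_poly (fin_matrix S M) = char_poly J"
proof -
  define N where "N = card S"
  have len: "length vs = N"
    using card_basis_seqs[OF S basis] distinct_card[OF dist] by (simp add: N_def)
  let ?e = "from_nat_into S"
  have bij: "bij_betw ?e {..<N} S"
    using bij_betw_from_nat_into_finite[OF S] by (simp add: N_def)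
  have e: "?e a \<in> S" if "a < N" for a
    using bij that by (auto simp: bij_betw_def)
  have e_eq: "?e a = ?e b \<longleftrightarrow> a = b" if "a < N" "b < N" for a b
    using bij that by (auto simp: bij_betw_def inj_on_def)
  define X where "X = fin_matrix S M"
  have X: "X \<in> carrier_mat N N" "\<And>a b. a < N \<Longrightarrow> b < N \<Longrightarrow> X $$ (a, b) = M (?e a) (?e b)"
    by (auto simp: X_def fin_matrix_def N_def)
  define P where "P = Matrix.mat N N (\<lambda>(i, a). (vs ! i) (?e a))"
  have P: "P \<in> carrier_mat N N" by (simp add: P_def)
  have "\<exists>u. unit_row (?e a) = (\<Sum>j<N. cscale (u j) (vs ! j))" if "a < N" for a
  proof -
    have "unit_row (?e a) \<in> cfun.span (set vs)"
      using basis e[OF that] by (auto simp: is_basis_def seqs_def unit_row_def)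
    then obtain u where "unit_row (?e a) = (\<Sum>v\<in>set vs. cscale (u v) v)"
      by (auto simp: in_span_finite_iff)
    also have "\<dots> = (\<Sum>j<N. cscale (u (vs ! j)) (vs ! j))"
      by (rule sum.reindex_bij_betw[symmetric]) (use bij_betw_nth[OF dist refl refl] len in simp)
    finally show ?thesis by (intro exI)
  qed
  then obtain q where q: "\<And>a. a < N \<Longrightarrow> unit_row (?e a) = (\<Sum>j<N. cscale (q a j) (vs ! j))"
    by metis
  define Q where "Q = Matrix.mat N N (\<lambda>(a, j). q a j)"
  have Q: "Q \<in> carrier_mat N N" by (simp add: Q_def)
  have QP: "Q * P = 1\<^sub>m N"
  proof (rule eq_matI)
    fix a b assume ab: "a < dim_row (1\<^sub>m N :: complex mat)" "b < dim_col (1\<^sub>m N :: complex mat)"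
    have "(Q * P) $$ (a, b) = (\<Sum>j<N. q a j * (vs ! j) (?e b))"
      using ab by (simp add: P_def Q_def scalar_prod_def atLeast0LessThan)
    also have "\<dots> = unit_row (?e a) (?e b)"
      using q[of a] ab by (simp add: sum_fun_apply cscale_def)
    finally show "(Q * P) $$ (a, b) = 1\<^sub>m N $$ (a, b)"
      using ab e_eq[of a b] by (auto simp: unit_row_def)
  qed (simp_all add: P_def Q_def)
  have PQ: "P * Q = 1\<^sub>m N"
    by (rule mat_mult_left_right_inverse[OF Q P QP])
  have J': "J \<in> carrier_mat N N" using J len by simp
  have PX: "P * X = J * P"
  proof (rule eq_matI)
    fix i b assume "i < dim_row (J * P)" "b < dim_col (J * P)"
    then have ib: "i < N" "b < N" using J' P by auto
    have "(P * X) $$ (i, b) = (\<Sum>a<N. (vs ! i) (?e a) * M (?e a) (?e b))"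
      using ib X by (simp add: P_def scalar_prod_def atLeast0LessThan)
    also have "\<dots> = (\<Sum>s\<in>S. (vs ! i) s * M s (?e b))"
      by (rule sum.reindex_bij_betw[OF bij])
    also have "\<dots> = row_mult S M (vs ! i) (?e b)"
      using S e ib by (simp add: row_mult_finite)
    also have "\<dots> = (\<Sum>j<N. J $$ (i, j) * (vs ! j) (?e b))"
      using rows[of i] ib len by (simp add: sum_fun_apply cscale_def)
    also have "\<dots> = (J * P) $$ (i, b)"
      using ib J' by (simp add: P_def scalar_prod_def atLeast0LessThan)
    finally show "(P * X) $$ (i, b) = (J * P) $$ (i, b)" .
  qed (use J' X P in auto)
  have "X = (Q * P) * X"
    using QP X by simp
  also have "\<dots> = Q * J * P"
    using P Q X J' PX by (simp add: assoc_mult_mat[of _ N N _ N _ N])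
  finally have "similar_mat X J"
    unfolding similar_mat_def using similar_mat_witI[OF QP PQ _ X(1) J' Q P] by blast
  then show ?thesis
    unfolding X_def by (rule char_poly_similar)
qed

text \<open>The eigenvalue \<open>\<alpha> b\<close> is the diagonal entry of the Jordan matrix in the row of \<open>b\<close>. The
  Jordan matrix is triangular and similar to \<open>M\<close>, so its diagonal lists the roots of the
  characteristic polynomial with their multiplicities.\<close>

lemma jordan_basis_gen_eig:
  assumes S: "finite S" and jb: "jordan_basis S M B"
  obtains \<alpha> where "finite B" "\<And>b. b \<in> B \<Longrightarrow> b \<in> gen_eig (seqs S) (row_mult S M) (\<alpha> b)"
    "\<And>\<mu>. card {b \<in> B. \<alpha> b = \<mu>} = order \<mu> (char_poly (fin_matrix S M))"
proof -
  let ?T = "row_mult S M"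
  obtain vs n_as where basis: "is_basis (set vs) (seqs S)" and vs: "distinct vs" "set vs = B"
    and len: "sum_list (map fst n_as) = length vs"
    and rows: "\<And>i. i < length vs \<Longrightarrow>
      ?T (vs ! i) = (\<Sum>j<length vs. cscale (jordan_matrix n_as $$ (i, j)) (vs ! j))"
    using jb unfolding jordan_basis_def by blast
  define N where "N = length vs"
  define J where "J = jordan_matrix n_as"
  have J: "J \<in> carrier_mat N N"
    using jordan_matrix_carrier[of n_as] by (simp add: J_def N_def len)
  define a where "a i = J $$ (i, i)" for i
  note off = jordan_matrix_off_diag[of _ n_as, unfolded len, folded J_def N_def, folded a_def]
  note P = linD[OF lin_funpow[OF lin_shift_op[OF lin_row_mult]]]
  have nil: "(shift_op ?T (a i) ^^ d) (vs ! i) = 0" if "i < N" "d = N - i" for i d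
    using that
  proof (induction d arbitrary: i)
    case (Suc d)
    let ?R = "{..<N} - {i}"
    have "?T (vs ! i) = cscale (a i) (vs ! i) + (\<Sum>j\<in>?R. cscale (J $$ (i, j)) (vs ! j))"
      using rows[of i] Suc.prems by (simp add: J_def N_def a_def sum.remove[of "{..<length vs}" i])
    then have "shift_op ?T (a i) (vs ! i) = (\<Sum>j\<in>?R. cscale (J $$ (i, j)) (vs ! j))"
      by (simp add: shift_op_def)
    then have "(shift_op ?T (a i) ^^ Suc d) (vs ! i) =
        (shift_op ?T (a i) ^^ d) (\<Sum>j\<in>?R. cscale (J $$ (i, j)) (vs ! j))"
      by (simp only: funpow_Suc_right comp_apply)
    also have "\<dots> = (\<Sum>j\<in>?R. cscale (J $$ (i, j)) ((shift_op ?T (a i) ^^ d) (vs ! j)))"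
      by (simp only: P(2,5))
    also have "\<dots> = 0"
    proof (rule sum.neutral, rule ballI)
      fix j assume j: "j \<in> ?R"
      show "cscale (J $$ (i, j)) ((shift_op ?T (a i) ^^ d) (vs ! j)) = 0"
      proof (cases "J $$ (i, j) = 0")
        case False
        then have "j = Suc i" "a i = a j"
          using off[of i j] j Suc.prems by (auto simp: a_def)
        then have "(shift_op ?T (a i) ^^ d) (vs ! j) = 0"
          unfolding \<open>a i = a j\<close> using Suc.prems j by (intro Suc.IH) auto
        then show ?thesis
          by (simp only: cfun.scale_zero_right)
      qed simp
    qed
    finally show ?case .
  qed simp
  have bij: "bij_betw ((!) vs) {..<N} B"
    using bij_betw_nth[OF vs(1)] vs(2) by (simp add: N_def)
  define \<alpha> where "\<alpha> b = a (the_inv_into {..<N} ((!) vs) b)" for b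
  have \<alpha>: "\<alpha> (vs ! i) = a i" if "i < N" for i
    using that bij by (simp add: \<alpha>_def bij_betw_def the_inv_into_f_f)
  show thesis
  proof
    show "finite B" using vs by auto
    show "b \<in> gen_eig (seqs S) ?T (\<alpha> b)" if b: "b \<in> B" for b
    proof -
      have "b \<in> seqs S"
        using basis b vs(2) cfun.span_superset by (auto simp: is_basis_def)
      moreover obtain i where "i < N" "b = vs ! i"
        using b vs(2) by (auto simp: in_set_conv_nth N_def)
      ultimately show ?thesis
        using nil[of i "N - i"] \<alpha> by (auto simp: gen_eig_iff)
    qed
    show "card {b \<in> B. \<alpha> b = \<mu>} = order \<mu> (char_poly (fin_matrix S M))" for \<mu>
    proof -
      have "{b \<in> B. \<alpha> b = \<mu>} = (!) vs ` {i. i < N \<and> a i = \<mu>}"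
        using \<alpha> bij by (force simp: bij_betw_def)
      then have "card {b \<in> B. \<alpha> b = \<mu>} = card {i. i < N \<and> a i = \<mu>}"
        using bij by (auto simp: bij_betw_def intro!: card_image intro: inj_on_subset)
      also have "\<dots> = count_list (diag_mat J) \<mu>"
        using J by (auto simp: count_list_eq_length_filter length_filter_conv_card diag_mat_def a_def
            intro!: arg_cong[where f = card])
      also have "\<dots> = order \<mu> (char_poly J)"
        using J jordan_matrix_upper_triangular[of _ n_as, folded J_def]
        by (subst char_poly_upper_triangular[of J N])
          (auto simp: order_linear_factors len N_def upper_triangular_def)
      also have "char_poly J = char_poly (fin_matrix S M)"
        using char_poly_basis_change[OF S basis vs(1)] J rows by (simp add: J_def N_def)
      finally show ?thesis .
    qed
  qed
qed

text \<open>A vector annihilated by some power of \<open>T - \<mu>I\<close> has a least such power, which is positive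
  unless the vector is \<open>0\<close>.\<close>

lemma associated_iff:
  assumes "v \<in> seqs S"
  shows "associated S M \<mu> v \<longleftrightarrow> v \<noteq> 0 \<and> v \<in> gen_eig (seqs S) (row_mult S M) \<mu>"
proof
  have 0: "(shift_op (row_mult S M) \<mu> ^^ k) 0 = 0" for k
    by (rule linD(3)[OF lin_funpow[OF lin_shift_op[OF lin_row_mult]]])
  assume "associated S M \<mu> v"
  then obtain k where k: "v \<in> ker_pow (seqs S) (row_mult S M) \<mu> k"
      "v \<notin> ker_pow (seqs S) (row_mult S M) \<mu> (k - 1)"
    unfolding associated_def in_level_def by blast
  show "v \<noteq> 0 \<and> v \<in> gen_eig (seqs S) (row_mult S M) \<mu>"
  proof
    show "v \<noteq> 0"
      using k(2) assms 0[of "k - 1"] unfolding ker_pow_iff by metis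
    show "v \<in> gen_eig (seqs S) (row_mult S M) \<mu>"
      using k(1) unfolding gen_eig_def by (rule UN_I[OF UNIV_I])
  qed
next
  define Z where "Z k \<longleftrightarrow> (shift_op (row_mult S M) \<mu> ^^ k) v = 0" for k
  assume v: "v \<noteq> 0 \<and> v \<in> gen_eig (seqs S) (row_mult S M) \<mu>"
  define k where "k = (LEAST k. Z k)"
  have "\<exists>k. Z k" using v unfolding gen_eig_iff Z_def by simp
  then have Z: "Z k" unfolding k_def by (rule LeastI_ex)
  have "k \<noteq> 0"
  proof
    assume "k = 0"
    with Z v show False unfolding Z_def by simp
  qed
  moreover have "\<not> Z (k - 1)"
    using \<open>k \<noteq> 0\<close> unfolding k_def by (intro not_less_Least) simp
  ultimately have "in_level S M \<mu> k v"
    using Z assms unfolding in_level_def Diff_iff ker_pow_iff Z_def by simp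
  then show "associated S M \<mu> v"
    unfolding associated_def by (rule exI)
qed

section \<open>Extending generalised eigenvectors along a filtration\<close>

text \<open>The columns of \<open>M\<close> indexed by level \<open>i + 1\<close> are supported in level \<open>i\<close>, so the value of
  \<open>Y M\<close> at a level only depends on \<open>Y\<close> one level below. Therefore \<open>Y \<mapsto> Y M\<close> is locally
  nilpotent on the families which vanish on some level.\<close>

locale column_filtration =
  fixes \<Gamma> :: "'a set" and M :: "'a \<Rightarrow> 'a \<Rightarrow> complex" and \<Omega> :: "nat \<Rightarrow> 'a set"
  assumes level_mono: "\<Omega> i \<subseteq> \<Omega> (Suc i)"
    and levels_cover: "(\<Union>i. \<Omega> i) = \<Gamma>"
    and column_0: "\<lbrakk>j \<in> \<Omega> 0; k \<in> \<Gamma>; M k j \<noteq> 0\<rbrakk> \<Longrightarrow> k \<in> \<Omega> 0"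
    and column_Suc: "\<lbrakk>j \<in> \<Omega> (Suc i); k \<in> \<Gamma>; M k j \<noteq> 0\<rbrakk> \<Longrightarrow> k \<in> \<Omega> i"
begin

abbreviation "L \<equiv> row_mult \<Gamma> M"
abbreviation "T n \<equiv> row_mult (\<Omega> n) M"

lemma level_le: "i \<le> j \<Longrightarrow> \<Omega> i \<subseteq> \<Omega> j"
  by (rule lift_Suc_mono_le[of \<Omega>]) (use level_mono in auto)

lemma level_subset: "\<Omega> n \<subseteq> \<Gamma>"
  using levels_cover by auto

lemma level_above:
  assumes "j \<in> \<Gamma>"
  obtains d where "j \<in> \<Omega> (n + d)"
proof -
  obtain i where "j \<in> \<Omega> i" using assms levels_cover by auto
  then have "j \<in> \<Omega> (n + i)" using level_le[of i "n + i"] by auto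
  then show thesis by (rule that)
qed

lemma column_same: "\<lbrakk>j \<in> \<Omega> n; k \<in> \<Gamma>; M k j \<noteq> 0\<rbrakk> \<Longrightarrow> k \<in> \<Omega> n"
  using column_0 column_Suc level_mono by (cases n) blast+

lemma L_local:
  assumes "\<And>k. k \<in> \<Omega> i \<Longrightarrow> Y k = Z k" "j \<in> \<Omega> (Suc i)"
  shows "L Y j = L Z j"
  using column_Suc[OF assms(2)] assms(1) by (auto simp: row_mult_def intro!: sum.cong)

lemma restr_L: "restr (\<Omega> n) (L Y) = T n (restr (\<Omega> n) Y)"
proof
  fix j
  have "{k \<in> \<Gamma>. M k j \<noteq> 0} = {k \<in> \<Omega> n. M k j \<noteq> 0}" if "j \<in> \<Omega> n"
    using column_same[OF that] level_subset by auto
  then show "restr (\<Omega> n) (L Y) j = T n (restr (\<Omega> n) Y) j"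
    using level_subset by (auto simp: restr_def row_mult_def intro!: sum.cong)
qed

lemma restr_shift_pow:
  "restr (\<Omega> n) ((shift_op L \<mu> ^^ k) Y) = (shift_op (T n) \<mu> ^^ k) (restr (\<Omega> n) Y)"
proof (induction k)
  case (Suc k)
  have "restr (\<Omega> n) (shift_op L \<mu> Z) = shift_op (T n) \<mu> (restr (\<Omega> n) Z)" for Z
    unfolding shift_op_def linD(2,4)[OF lin_restr] restr_L ..
  then show ?case by (simp add: Suc)
qed simp

lemma restr_eq_0_iff: "restr S Y = 0 \<longleftrightarrow> (\<forall>j\<in>S. Y j = 0)"
  by (auto simp: restr_def fun_eq_iff)

text \<open>If \<open>Y L = \<mu> Y\<close> vanishes on a level, then it vanishes on the next one, since \<open>\<mu> \<noteq> 0\<close>; the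
  induction on \<open>k\<close> reduces generalised eigenvectors to this case.\<close>

lemma restr_gen_eig_eq_0:
  assumes \<mu>: "\<mu> \<noteq> 0"
  shows "Y \<in> seqs \<Gamma> \<Longrightarrow> restr (\<Omega> n) Y = 0 \<Longrightarrow> (shift_op L \<mu> ^^ k) Y = 0 \<Longrightarrow> Y = 0"
proof (induction k arbitrary: Y)
  case (Suc k)
  have "shift_op L \<mu> Y = 0"
  proof (rule Suc.IH)
    show "shift_op L \<mu> Y \<in> seqs \<Gamma>"
      unfolding shift_op_def
      by (intro cfun.subspace_diff[OF subspace_seqs] cfun.subspace_scale[OF subspace_seqs]
          row_mult_in_seqs Suc.prems(1))
    have "restr (\<Omega> n) ((shift_op L \<mu> ^^ 1) Y) = 0"
      unfolding restr_shift_pow Suc.prems(2)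
      by (rule linD(3)[OF lin_funpow[OF lin_shift_op[OF lin_row_mult]]])
    then show "restr (\<Omega> n) (shift_op L \<mu> Y) = 0" by simp
    show "(shift_op L \<mu> ^^ k) (shift_op L \<mu> Y) = 0"
      using Suc.prems(3) by (simp only: funpow_Suc_right comp_apply)
  qed
  then have ev: "L Y j = \<mu> * Y j" for j
    by (auto simp: shift_op_def cscale_def fun_eq_iff)
  have level: "\<forall>j\<in>\<Omega> (n + d). Y j = 0" for d
  proof (induction d)
    case 0
    show ?case using Suc.prems(2) unfolding restr_eq_0_iff by simp
  next
    case (Suc d)
    show ?case
    proof
      fix j assume j: "j \<in> \<Omega> (n + Suc d)"
      have "L Y j = L 0 j"
        by (rule L_local[of "n + d"]) (use Suc j in auto)
      then have "L Y j = 0"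
        using linD(3)[OF lin_row_mult[of \<Gamma> M]] by simp
      then show "Y j = 0" using ev[of j] \<mu> by simp
    qed
  qed
  show ?case
  proof
    fix j
    show "Y j = 0 j"
    proof (cases "j \<in> \<Gamma>")
      case True
      then obtain d where "j \<in> \<Omega> (n + d)" by (rule level_above)
      then show ?thesis using level[of d] by simp
    next
      case False
      then show ?thesis using Suc.prems(1) by (simp add: seqs_def)
    qed
  qed
qed simp

lemma inj_on_restr:
  assumes "\<mu> \<noteq> 0"
  shows "inj_on (restr (\<Omega> n)) (gen_eig (seqs \<Gamma>) L \<mu>)"
proof (rule inj_onI)
  fix Y Z assume YZ: "Y \<in> gen_eig (seqs \<Gamma>) L \<mu>" "Z \<in> gen_eig (seqs \<Gamma>) L \<mu>"
    "restr (\<Omega> n) Y = restr (\<Omega> n) Z"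
  have "Y - Z \<in> gen_eig (seqs \<Gamma>) L \<mu>"
    by (rule cfun.subspace_diff[OF subspace_gen_eig[OF lin_row_mult subspace_seqs] YZ(1,2)])
  moreover have "restr (\<Omega> n) (Y - Z) = 0"
    unfolding linD(4)[OF lin_restr] YZ(3) by simp
  ultimately have "Y - Z = 0"
    using restr_gen_eig_eq_0[OF assms] unfolding gen_eig_iff by blast
  then show "Y = Z" by simp
qed

text \<open>The iteration \<open>z \<mapsto> \<mu>\<^sup>-\<^sup>1(z L - W)\<close> started at \<open>0\<close> becomes stationary on every level; it
  sums the Neumann series of \<open>(L - \<mu>I)\<^sup>-\<^sup>1 W\<close>.\<close>

lemma shift_op_surj:
  assumes \<mu>: "\<mu> \<noteq> 0" and W: "W \<in> seqs \<Gamma>" "restr (\<Omega> n) W = 0"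
  shows "\<exists>Z\<in>seqs \<Gamma>. restr (\<Omega> n) Z = 0 \<and> shift_op L \<mu> Z = W"
proof -
  define z where "z = rec_nat 0 (\<lambda>_ y j. (L y j - W j) / \<mu>)"
  have z0: "z 0 = 0" and zS: "z (Suc d) j = (L (z d) j - W j) / \<mu>" for d j
    by (simp_all add: z_def)
  have step: "\<forall>j\<in>\<Omega> (n + d). z (Suc d) j = z d j" for d
  proof (induction d)
    case 0
    show ?case
      using W(2) linD(3)[OF lin_row_mult[of \<Gamma> M]] unfolding zS z0 by (simp add: restr_eq_0_iff)
  next
    case (Suc d)
    show ?case
    proof
      fix j assume "j \<in> \<Omega> (n + Suc d)"
      then have "L (z (Suc d)) j = L (z d) j"
        using Suc by (intro L_local[of "n + d"]) auto
      then show "z (Suc (Suc d)) j = z (Suc d) j"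
        unfolding zS[of "Suc d"] zS[of d] by simp
    qed
  qed
  have stat: "z (d + e) j = z d j" if "j \<in> \<Omega> (n + d)" for d e j
  proof (induction e)
    case (Suc e)
    have "j \<in> \<Omega> (n + (d + e))"
      using that level_le[of "n + d" "n + (d + e)"] by auto
    then show ?case
      using Suc step[of "d + e"] by simp
  qed simp
  define Z where "Z j = (if j \<in> \<Gamma> then z (LEAST d. j \<in> \<Omega> (n + d)) j else 0)" for j
  have Z: "Z j = z d j" if "j \<in> \<Omega> (n + d)" for d j
  proof -
    let ?m = "LEAST d. j \<in> \<Omega> (n + d)"
    have "j \<in> \<Omega> (n + ?m)" by (rule LeastI[of "\<lambda>d. j \<in> \<Omega> (n + d)", OF that])
    moreover have "?m \<le> d" by (rule Least_le[of "\<lambda>d. j \<in> \<Omega> (n + d)", OF that])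
    ultimately have "z d j = z ?m j" using stat[of j ?m "d - ?m"] by simp
    then show ?thesis using that level_subset by (auto simp: Z_def)
  qed
  show ?thesis
  proof (intro bexI conjI)
    show "Z \<in> seqs \<Gamma>" by (simp add: seqs_def Z_def)
    show "restr (\<Omega> n) Z = 0"
      using Z[of _ 0] by (simp add: restr_eq_0_iff z0)
    show "shift_op L \<mu> Z = W"
    proof
      fix j
      show "shift_op L \<mu> Z j = W j"
      proof (cases "j \<in> \<Gamma>")
        case True
        then obtain d where d: "j \<in> \<Omega> (n + d)" by (rule level_above)
        then have j: "j \<in> \<Omega> (n + Suc d)" using level_mono by auto
        have "L Z j = L (z d) j"
          using j Z by (intro L_local[of "n + d"]) auto
        moreover have "Z j = (L (z d) j - W j) / \<mu>"
          using Z[OF j] by (simp add: zS)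
        ultimately show ?thesis
          using \<mu> by (simp add: shift_op_def cscale_def)
      next
        case False
        then show ?thesis
          using W(1) by (simp add: shift_op_def cscale_def seqs_def Z_def row_mult_def)
      qed
    qed
  qed
qed

lemma shift_op_pow_surj:
  assumes "\<mu> \<noteq> 0"
  shows "W \<in> seqs \<Gamma> \<Longrightarrow> restr (\<Omega> n) W = 0 \<Longrightarrow>
    \<exists>Z\<in>seqs \<Gamma>. restr (\<Omega> n) Z = 0 \<and> (shift_op L \<mu> ^^ k) Z = W"
proof (induction k arbitrary: W)
  case (Suc k)
  obtain V where V: "V \<in> seqs \<Gamma>" "restr (\<Omega> n) V = 0" "shift_op L \<mu> V = W"
    using shift_op_surj[OF assms Suc.prems] by blast
  obtain Z where "Z \<in> seqs \<Gamma>" "restr (\<Omega> n) Z = 0" "(shift_op L \<mu> ^^ k) Z = V"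
    using Suc.IH[OF V(1,2)] by blast
  then show ?case
    using V(3) by (intro bexI[of _ Z] conjI) simp_all
qed auto

lemma seqs_shift_pow:
  assumes "Y \<in> seqs \<Gamma>"
  shows "(shift_op L \<mu> ^^ k) Y \<in> seqs \<Gamma>"
proof (induction k)
  case (Suc k)
  then show ?case
    unfolding funpow.simps comp_apply shift_op_def[of L \<mu>]
    by (intro cfun.subspace_diff[OF subspace_seqs] cfun.subspace_scale[OF subspace_seqs]
        row_mult_in_seqs)
qed (use assms in simp)

text \<open>The extension by zero fails to lie in the kernel only by a family vanishing on the level,
  which can be corrected without changing the values on the level.\<close>

lemma extension_exists:
  assumes \<mu>: "\<mu> \<noteq> 0" and v: "v \<in> ker_pow (seqs (\<Omega> n)) (T n) \<mu> k"
  shows "\<exists>Y\<in>ker_pow (seqs \<Gamma>) L \<mu> k. restr (\<Omega> n) Y = v"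
proof -
  have vS: "v \<in> seqs (\<Omega> n)" and v0: "(shift_op (T n) \<mu> ^^ k) v = 0"
    using v unfolding ker_pow_iff by auto
  have v\<Gamma>: "v \<in> seqs \<Gamma>" using vS level_subset by (auto simp: seqs_def)
  have rv: "restr (\<Omega> n) v = v" using vS by (auto simp: seqs_def restr_def)
  have "restr (\<Omega> n) ((shift_op L \<mu> ^^ k) v) = 0"
    unfolding restr_shift_pow rv v0 ..
  then obtain Z where Z: "Z \<in> seqs \<Gamma>" "restr (\<Omega> n) Z = 0"
      "(shift_op L \<mu> ^^ k) Z = (shift_op L \<mu> ^^ k) v"
    using shift_op_pow_surj[OF \<mu> seqs_shift_pow[OF v\<Gamma>]] by blast
  show ?thesis
  proof (rule bexI[of _ "v - Z"])
    show "restr (\<Omega> n) (v - Z) = v"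
      unfolding linD(4)[OF lin_restr] rv Z(2) by simp
    show "v - Z \<in> ker_pow (seqs \<Gamma>) L \<mu> k"
      unfolding ker_pow_iff linD(4)[OF lin_funpow[OF lin_shift_op[OF lin_row_mult]]] Z(3)
      using cfun.subspace_diff[OF subspace_seqs v\<Gamma> Z(1)] by simp
  qed
qed

lemma extension_seq:
  assumes \<mu>: "\<mu> \<noteq> 0" and v: "associated (\<Omega> n) M \<mu> v"
  shows "extension_seq \<Gamma> (\<Omega> n) M \<mu> v \<in> gen_eig (seqs \<Gamma>) L \<mu>"
    "restr (\<Omega> n) (extension_seq \<Gamma> (\<Omega> n) M \<mu> v) = v"
proof -
  let ?P = "\<lambda>Y. restr (\<Omega> n) Y = v \<and> (\<exists>k. in_level (\<Omega> n) M \<mu> k v \<and> Y \<in> ker_pow (seqs \<Gamma>) L \<mu> k)"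
  have gen: "Y \<in> gen_eig (seqs \<Gamma>) L \<mu>" if "?P Y" for Y
    using that by (auto simp: gen_eig_def)
  obtain k where k: "in_level (\<Omega> n) M \<mu> k v"
    using v by (auto simp: associated_def)
  then obtain Y where Y: "?P Y"
    using extension_exists[OF \<mu>, of v n k] by (auto simp: in_level_def)
  have "extension_seq \<Gamma> (\<Omega> n) M \<mu> v = Y"
    unfolding extension_seq_def
  proof (rule the_equality)
    show "?P Y" by fact
    show "Z = Y" if "?P Z" for Z
      using inj_onD[OF inj_on_restr[OF \<mu>, of n] _ gen[OF that] gen[OF Y]] that Y by simp
  qed
  then show "extension_seq \<Gamma> (\<Omega> n) M \<mu> v \<in> gen_eig (seqs \<Gamma>) L \<mu>"
    "restr (\<Omega> n) (extension_seq \<Gamma> (\<Omega> n) M \<mu> v) = v"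
    using gen Y by auto
qed

lemma restr_gen_eig: "restr (\<Omega> n) ` gen_eig (seqs \<Gamma>) L \<mu> \<subseteq> gen_eig (seqs (\<Omega> n)) (T n) \<mu>"
proof
  fix v assume "v \<in> restr (\<Omega> n) ` gen_eig (seqs \<Gamma>) L \<mu>"
  then obtain Y k where Y: "v = restr (\<Omega> n) Y" "(shift_op L \<mu> ^^ k) Y = 0"
    unfolding gen_eig_iff by (auto simp: gen_eig_iff)
  have "(shift_op (T n) \<mu> ^^ k) v = 0"
    unfolding Y(1) restr_shift_pow[symmetric] Y(2) by (rule linD(3)[OF lin_restr])
  then show "v \<in> gen_eig (seqs (\<Omega> n)) (T n) \<mu>"
    unfolding gen_eig_iff using Y(1) by (auto simp: seqs_def restr_def)
qed

end

section \<open>Lattices and dilations\<close>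

lemma matrix_inv_mult_vec:
  fixes A :: "real^'n^'n"
  assumes "\<And>x. A *v x = 0 \<Longrightarrow> x = 0"
  shows "A *v (matrix_inv A *v x) = x" "matrix_inv A *v (A *v x) = x"
proof -
  have "\<exists>B::real^'n^'n. B ** A = Finite_Cartesian_Product.mat 1"
    unfolding matrix_left_invertible_ker using assms by blast
  then have "\<exists>B::real^'n^'n. A ** B = Finite_Cartesian_Product.mat 1 \<and> B ** A = Finite_Cartesian_Product.mat 1"
    using matrix_left_right_inverse by blast
  then have "A ** matrix_inv A = Finite_Cartesian_Product.mat 1 \<and>
      matrix_inv A ** A = Finite_Cartesian_Product.mat 1"
    unfolding matrix_inv_def by (rule someI_ex)
  then show "A *v (matrix_inv A *v x) = x" "matrix_inv A *v (A *v x) = x"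
    by (simp_all add: matrix_vector_mul_assoc)
qed

lemma finite_vec_components:
  assumes "finite I"
  shows "finite {x :: 'a^'n. \<forall>i. vec_nth x i \<in> I}"
proof -
  have "finite (vec_nth ` {x :: 'a^'n. \<forall>i. vec_nth x i \<in> I})"
    by (rule finite_subset[of _ "PiE UNIV (\<lambda>_. I)"]) (use assms in \<open>auto intro: finite_PiE\<close>)
  then show ?thesis
    by (rule finite_imageD) (simp add: inj_on_def vec_nth_inject)
qed

lemma lattice_closed:
  fixes \<Gamma> :: "(real^'d) set"
  assumes "is_lattice \<Gamma>"
  shows "x \<in> \<Gamma> \<Longrightarrow> y \<in> \<Gamma> \<Longrightarrow> x - y \<in> \<Gamma>" "x \<in> \<Gamma> \<Longrightarrow> - x \<in> \<Gamma>"
proof -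
  obtain M :: "real^'d^'d" where \<Gamma>: "\<Gamma> = (\<lambda>x. M *v x) ` {x. \<forall>i. vec_nth x i \<in> \<int>}"
    using assms by (auto simp: is_lattice_def)
  have diff: "x - y \<in> \<Gamma>" if "x \<in> \<Gamma>" "y \<in> \<Gamma>" for x y
  proof -
    obtain u v where "x = M *v u" "y = M *v v" "\<forall>i. vec_nth u i \<in> \<int>" "\<forall>i. vec_nth v i \<in> \<int>"
      using \<open>x \<in> \<Gamma>\<close> \<open>y \<in> \<Gamma>\<close> unfolding \<Gamma> by blast
    then show ?thesis
      unfolding \<Gamma> by (intro image_eqI[of _ _ "u - v"]) (auto simp: matrix_vector_mult_diff_distrib)
  qed
  have "0 \<in> \<Gamma>"
    unfolding \<Gamma> by (rule image_eqI[of _ _ 0]) auto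
  then have neg: "- x \<in> \<Gamma>" if "x \<in> \<Gamma>" for x
    using diff[of 0 x] that by simp
  show "x \<in> \<Gamma> \<Longrightarrow> y \<in> \<Gamma> \<Longrightarrow> x - y \<in> \<Gamma>" "x \<in> \<Gamma> \<Longrightarrow> - x \<in> \<Gamma>"
    using diff neg by auto
qed

lemma finite_lattice_bounded:
  fixes \<Gamma> :: "(real^'d) set"
  assumes "is_lattice \<Gamma>" "bounded S"
  shows "finite (\<Gamma> \<inter> S)"
proof -
  obtain M :: "real^'d^'d" where M: "invertible M" and
    \<Gamma>: "\<Gamma> = (\<lambda>x. M *v x) ` {x. \<forall>i. vec_nth x i \<in> \<int>}"
    using assms(1) by (auto simp: is_lattice_def)
  obtain N where N: "N ** M = Finite_Cartesian_Product.mat 1"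
    using M by (auto simp: invertible_def)
  have NM: "N *v (M *v x) = x" for x
    by (simp add: matrix_vector_mul_assoc N)
  have "bounded ((\<lambda>x. N *v x) ` S)"
    using assms(2) matrix_vector_mul_bounded_linear by (rule bounded_linear_image)
  then obtain b where b: "\<And>x. x \<in> S \<Longrightarrow> norm (N *v x) \<le> b"
    by (auto simp: bounded_iff)
  let ?I = "of_int ` {-\<lceil>b\<rceil>..\<lceil>b\<rceil>} :: real set"
  have "\<Gamma> \<inter> S \<subseteq> (\<lambda>x. M *v x) ` {x. \<forall>i. vec_nth x i \<in> ?I}"
  proof
    fix y assume y: "y \<in> \<Gamma> \<inter> S"
    then obtain x where x: "y = M *v x" "\<forall>i. vec_nth x i \<in> \<int>"
      by (auto simp: \<Gamma>)
    have "vec_nth x i \<in> ?I" for i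
    proof -
      obtain z where z: "vec_nth x i = of_int z" using x(2) by (auto elim!: Ints_cases)
      have "\<bar>of_int z :: real\<bar> \<le> b"
        using b[of y] y component_le_norm_cart[of x i] by (simp add: x(1) NM z)
      then have "\<bar>z\<bar> \<le> \<lceil>b\<rceil>" by linarith
      then have "z \<in> {-\<lceil>b\<rceil>..\<lceil>b\<rceil>}" by auto
      then show ?thesis unfolding z by (rule imageI)
    qed
    then show "y \<in> (\<lambda>x. M *v x) ` {x. \<forall>i. vec_nth x i \<in> ?I}"
      using x(1) by auto
  qed
  moreover have "finite ((\<lambda>x. M *v x) ` {x. \<forall>i. vec_nth x i \<in> ?I})"
    by (intro finite_imageI finite_vec_components) auto
  ultimately show ?thesis
    by (rule finite_subset)
qed

text \<open>A real vector in the kernel would be a complex eigenvector to \<open>0\<close>.\<close>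

lemma dilation_ker:
  fixes A :: "real^'d^'d"
  assumes "is_dilation \<Gamma> A" "A *v x = 0"
  shows "x = 0"
proof (rule ccontr)
  assume x: "x \<noteq> 0"
  let ?v = "\<chi> i. complex_of_real (vec_nth x i)"
  have "?v \<noteq> 0" using x by (auto simp: Finite_Cartesian_Product.vec_eq_iff)
  moreover have "map_matrix complex_of_real A *v ?v = 0 *s ?v"
  proof (subst Finite_Cartesian_Product.vec_eq_iff, rule allI)
    fix i
    have "vec_nth (map_matrix complex_of_real A *v ?v) i = of_real (vec_nth (A *v x) i)"
      by (simp add: matrix_vector_mult_def map_matrix_def)
    then show "vec_nth (map_matrix complex_of_real A *v ?v) i = vec_nth (0 *s ?v) i"
      using assms(2) by simp
  qed
  ultimately have "norm (0 :: complex) > 1"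
    using assms(1) unfolding is_dilation_def by blast
  then show False by simp
qed

section \<open>Refinable functions\<close>

lemma finite_translates:
  fixes \<Gamma> :: "(real^'d) set"
  assumes "is_lattice \<Gamma>" "compactly_supported \<phi>"
  shows "finite {k \<in> \<Gamma>. \<phi> (x + k) \<noteq> 0}"
proof -
  have "bounded {x. \<phi> x \<noteq> 0}"
    using assms(2) compact_imp_bounded bounded_subset closure_subset
    unfolding compactly_supported_def by blast
  then have "bounded ((+) (- x) ` {x. \<phi> x \<noteq> 0})"
    by (rule bounded_translation)
  then have "finite (\<Gamma> \<inter> (+) (- x) ` {x. \<phi> x \<noteq> 0})"
    by (rule finite_lattice_bounded[OF assms(1)])
  moreover have "{k \<in> \<Gamma>. \<phi> (x + k) \<noteq> 0} \<subseteq> \<Gamma> \<inter> (+) (- x) ` {x. \<phi> x \<noteq> 0}"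
    by (auto intro!: image_eqI[of _ _ "x + _"])
  ultimately show ?thesis
    by (rule rev_finite_subset)
qed

lemma inj_on_combine:
  assumes \<Gamma>: "is_lattice \<Gamma>" and indep: "translates_independent \<Gamma> \<phi>"
  shows "inj_on (combine \<Gamma> \<phi>) (seqs \<Gamma>)"
proof (rule inj_onI)
  fix Y Z assume YZ: "Y \<in> seqs \<Gamma>" "Z \<in> seqs \<Gamma>" "combine \<Gamma> \<phi> Y = combine \<Gamma> \<phi> Z"
  define W where "W = Y - Z"
  have W: "W \<in> seqs \<Gamma>"
    unfolding W_def by (rule cfun.subspace_diff[OF subspace_seqs YZ(1,2)])
  have W0: "combine \<Gamma> \<phi> W = 0"
    unfolding W_def linD(4)[OF lin_combine] YZ(3) by simp
  define \<alpha> where "\<alpha> k = W (- k)" for k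
  have mem: "- k \<in> \<Gamma> \<longleftrightarrow> k \<in> \<Gamma>" for k
    using lattice_closed(2)[OF \<Gamma>, of k] lattice_closed(2)[OF \<Gamma>, of "- k"] by auto
  have "\<alpha> \<in> seqs \<Gamma>"
    using W by (simp add: seqs_def \<alpha>_def mem)
  moreover have "(\<Sum>k | k \<in> \<Gamma> \<and> \<phi> (x - k) \<noteq> 0. \<alpha> k * \<phi> (x - k)) = 0" for x
  proof -
    have "(\<Sum>k | k \<in> \<Gamma> \<and> \<phi> (x - k) \<noteq> 0. \<alpha> k * \<phi> (x - k)) = combine \<Gamma> \<phi> W x"
      unfolding combine_def
      by (rule sum.reindex_bij_witness[of _ uminus uminus]) (auto simp: \<alpha>_def mem)
    then show ?thesis by (simp add: W0)
  qed
  ultimately have \<alpha>0: "\<forall>k\<in>\<Gamma>. \<alpha> k = 0"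
    using indep unfolding translates_independent_def by blast
  have "Y k = Z k" for k
  proof (cases "k \<in> \<Gamma>")
    case True
    then have "\<alpha> (- k) = 0" using \<alpha>0 mem by blast
    then show ?thesis by (simp add: \<alpha>_def W_def)
  next
    case False
    then show ?thesis using YZ by (simp add: seqs_def)
  qed
  then show "Y = Z" by blast
qed

text \<open>Substituting the refinement equation into every translate of \<open>\<phi>\<close> and interchanging the two
  sums moves the matrix onto the coefficients.\<close>

lemma combine_row_mult:
  fixes \<Gamma> \<Lambda> :: "(real^'d) set"
  assumes \<Gamma>: "is_lattice \<Gamma>" and A: "is_dilation \<Gamma> A"
    and \<Lambda>: "finite \<Lambda>" "\<Lambda> \<subseteq> \<Gamma>" and c: "\<forall>k\<in>\<Gamma> - \<Lambda>. c k = 0"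
    and \<phi>: "compactly_supported \<phi>"
    and refine: "\<forall>x. \<phi> x = (\<Sum>k\<in>\<Lambda>. c k * \<phi> (A *v x - k))"
  shows "combine \<Gamma> \<phi> (row_mult \<Gamma> (refine_entry A c) Y) (A *v x) = combine \<Gamma> \<phi> Y x"
proof -
  have inv: "matrix_inv A *v (A *v x) = x" for x
    by (rule matrix_inv_mult_vec) (rule dilation_ker[OF A])
  have A\<Gamma>: "A *v i \<in> \<Gamma>" if "i \<in> \<Gamma>" for i
    using A that by (auto simp: is_dilation_def)
  define I where "I j = {i \<in> \<Gamma>. c (A *v i - j) \<noteq> 0}" for j
  define J where "J = {j \<in> \<Gamma>. \<phi> (A *v x + j) \<noteq> 0}"
  define K where "K = {i \<in> \<Gamma>. \<phi> (x + i) \<noteq> 0}"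
  have fin: "finite J" "finite K"
    unfolding J_def K_def by (rule finite_translates[OF \<Gamma> \<phi>])+
  have finI: "finite (I j)" if j: "j \<in> J" for j
  proof (rule finite_subset)
    show "I j \<subseteq> (\<lambda>l. matrix_inv A *v (l + j)) ` \<Lambda>"
    proof
      fix i assume i: "i \<in> I j"
      then have "A *v i - j \<in> \<Lambda>"
        using c j A\<Gamma> lattice_closed(1)[OF \<Gamma>] by (auto simp: I_def J_def)
      then show "i \<in> (\<lambda>l. matrix_inv A *v (l + j)) ` \<Lambda>"
        by (intro image_eqI[of _ _ "A *v i - j"]) (simp_all add: inv)
    qed
  qed (use \<Lambda> in simp)
  \<comment> \<open>One finite range of summation for \<open>i\<close>, the same for all \<open>j\<close>, so that the sums can be swapped.\<close>
  define R where "R = K \<union> (\<Union>j\<in>J. I j)"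
  have finR: "finite R" using fin finI by (auto simp: R_def)
  have R\<Gamma>: "R \<subseteq> \<Gamma>" by (auto simp: R_def K_def I_def)
  have inner: "(\<Sum>j\<in>J. c (A *v i - j) * \<phi> (A *v x + j)) = \<phi> (x + i)" if i: "i \<in> R" for i
  proof -
    have i\<Gamma>: "i \<in> \<Gamma>" using i R\<Gamma> by auto
    have "(\<Sum>j\<in>J. c (A *v i - j) * \<phi> (A *v x + j))
        = (\<Sum>j | j \<in> J \<and> A *v i - j \<in> \<Lambda>. c (A *v i - j) * \<phi> (A *v x + j))"
      using fin c A\<Gamma>[OF i\<Gamma>] lattice_closed(1)[OF \<Gamma>]
      by (intro sum.mono_neutral_right) (auto simp: J_def)
    also have "\<dots> = (\<Sum>l | l \<in> \<Lambda> \<and> \<phi> (A *v x + (A *v i - l)) \<noteq> 0. c l * \<phi> (A *v x + (A *v i - l)))"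
      using \<Lambda>(2) A\<Gamma>[OF i\<Gamma>] lattice_closed(1)[OF \<Gamma>]
      by (intro sum.reindex_bij_witness[of _ "\<lambda>l. A *v i - l" "\<lambda>j. A *v i - j"]) (auto simp: J_def)
    also have "\<dots> = (\<Sum>l\<in>\<Lambda>. c l * \<phi> (A *v x + (A *v i - l)))"
      using \<Lambda>(1) by (intro sum.mono_neutral_left) auto
    also have "\<dots> = \<phi> (x + i)"
      using refine[rule_format, of "x + i"] by (simp add: matrix_vector_right_distrib algebra_simps)
    finally show ?thesis .
  qed
  have "combine \<Gamma> \<phi> (row_mult \<Gamma> (refine_entry A c) Y) (A *v x)
      = (\<Sum>j\<in>J. (\<Sum>i\<in>I j. Y i * c (A *v i - j)) * \<phi> (A *v x + j))"
    by (auto simp: combine_def row_mult_def refine_entry_def J_def I_def intro!: sum.cong)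
  also have "\<dots> = (\<Sum>j\<in>J. (\<Sum>i\<in>R. Y i * c (A *v i - j)) * \<phi> (A *v x + j))"
  proof (rule sum.cong[OF refl])
    fix j assume j: "j \<in> J"
    have "(\<Sum>i\<in>I j. Y i * c (A *v i - j)) = (\<Sum>i\<in>R. Y i * c (A *v i - j))"
      using j R\<Gamma> finR by (intro sum.mono_neutral_left) (auto simp: R_def I_def)
    then show "(\<Sum>i\<in>I j. Y i * c (A *v i - j)) * \<phi> (A *v x + j)
        = (\<Sum>i\<in>R. Y i * c (A *v i - j)) * \<phi> (A *v x + j)" by simp
  qed
  also have "\<dots> = (\<Sum>i\<in>R. \<Sum>j\<in>J. Y i * (c (A *v i - j) * \<phi> (A *v x + j)))"
    unfolding sum_distrib_right by (subst sum.swap) (simp add: mult.assoc)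
  also have "\<dots> = (\<Sum>i\<in>R. Y i * \<phi> (x + i))"
    unfolding sum_distrib_left[symmetric] using inner by (intro sum.cong) auto
  also have "\<dots> = (\<Sum>i\<in>K. Y i * \<phi> (x + i))"
    using finR R\<Gamma> by (intro sum.mono_neutral_right) (auto simp: R_def K_def)
  also have "\<dots> = combine \<Gamma> \<phi> Y x"
    by (simp add: combine_def K_def)
  finally show ?thesis .
qed

definition dilate :: "real^'d^'d \<Rightarrow> (real^'d \<Rightarrow> complex) \<Rightarrow> real^'d \<Rightarrow> complex" where
  "dilate A h = (\<lambda>x. h (matrix_inv A *v x))"

lemma lin_dilate: "lin (dilate A)"
  by (rule linI) (auto simp: dilate_def cscale_def)

text \<open>Pascal's rule; \<open>g\<close> will be the sequence of values of \<open>h\<close> along the orbit of a point.\<close>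

lemma binomial_difference:
  fixes g :: "nat \<Rightarrow> complex"
  shows "(\<Sum>k=0..Suc r. of_nat (Suc r choose k) * (- \<mu>) ^ k * g (Suc r - k)) =
    (\<Sum>k=0..r. of_nat (r choose k) * (- \<mu>) ^ k * g (Suc (r - k))) -
    \<mu> * (\<Sum>k=0..r. of_nat (r choose k) * (- \<mu>) ^ k * g (r - k))"
proof -
  have "(\<Sum>k=0..Suc r. of_nat (Suc r choose k) * (- \<mu>) ^ k * g (Suc r - k)) =
      g (Suc r) + (\<Sum>k=0..r. of_nat (Suc r choose Suc k) * (- \<mu>) ^ Suc k * g (r - k))"
    by (subst sum.atLeast0_atMost_Suc_shift) simp
  also have "(\<Sum>k=0..r. of_nat (Suc r choose Suc k) * (- \<mu>) ^ Suc k * g (r - k)) =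
      (\<Sum>k=0..r. of_nat (r choose Suc k) * (- \<mu>) ^ Suc k * g (r - k)
        - \<mu> * (of_nat (r choose k) * (- \<mu>) ^ k * g (r - k)))"
    by (intro sum.cong) (auto simp: algebra_simps)
  also have "g (Suc r) + \<dots> = g (Suc r)
      + (\<Sum>k=0..r. of_nat (r choose Suc k) * (- \<mu>) ^ Suc k * g (r - k))
      - \<mu> * (\<Sum>k=0..r. of_nat (r choose k) * (- \<mu>) ^ k * g (r - k))"
    by (simp add: sum_subtractf sum_distrib_left)
  also have "g (Suc r) + (\<Sum>k=0..r. of_nat (r choose Suc k) * (- \<mu>) ^ Suc k * g (r - k))
      = (\<Sum>k=0..Suc r. of_nat (r choose k) * (- \<mu>) ^ k * g (Suc r - k))"
    by (subst sum.atLeast0_atMost_Suc_shift) simp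
  also have "\<dots> = (\<Sum>k=0..r. of_nat (r choose k) * (- \<mu>) ^ k * g (Suc r - k))"
    by simp
  also have "\<dots> = (\<Sum>k=0..r. of_nat (r choose k) * (- \<mu>) ^ k * g (Suc (r - k)))"
    by (intro sum.cong) (auto simp: Suc_diff_le)
  finally show ?thesis .
qed

lemma homogeneous_class_iff: "h \<in> homogeneous_class A \<mu> r \<longleftrightarrow> (shift_op (dilate A) \<mu> ^^ r) h = 0"
proof -
  let ?A = "\<lambda>y. matrix_inv A *v y"
  have "(shift_op (dilate A) \<mu> ^^ r) h x =
      (\<Sum>k=0..r. of_nat (r choose k) * (- \<mu>) ^ k * h ((?A ^^ (r - k)) x))" for x
  proof (induction r arbitrary: x)
    case (Suc r)
    have "(shift_op (dilate A) \<mu> ^^ Suc r) h x =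
        (shift_op (dilate A) \<mu> ^^ r) h (?A x) - \<mu> * (shift_op (dilate A) \<mu> ^^ r) h x"
      by (simp add: shift_op_def[of "dilate A"]) (simp add: dilate_def cscale_def)
    also have "\<dots> = (\<Sum>k=0..r. of_nat (r choose k) * (- \<mu>) ^ k * h ((?A ^^ Suc (r - k)) x)) -
        \<mu> * (\<Sum>k=0..r. of_nat (r choose k) * (- \<mu>) ^ k * h ((?A ^^ (r - k)) x))"
      unfolding Suc by (simp only: funpow_Suc_right comp_apply)
    also have "\<dots> = (\<Sum>k=0..Suc r. of_nat (Suc r choose k) * (- \<mu>) ^ k * h ((?A ^^ (Suc r - k)) x))"
      by (rule binomial_difference[where g = "\<lambda>j. h ((?A ^^ j) x)", symmetric])
    finally show ?case .
  qed simp
  then show ?thesis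
    by (simp add: homogeneous_class_def fun_eq_iff)
qed

lemma homogeneous_space_eq:
  "homogeneous_space \<Gamma> A \<phi> \<mu> = gen_eig (translate_space \<Gamma> \<phi>) (dilate A) \<mu>"
proof -
  have "(\<exists>k\<ge>1. (shift_op (dilate A) \<mu> ^^ k) h = 0) \<longleftrightarrow> (\<exists>k. (shift_op (dilate A) \<mu> ^^ k) h = 0)" for h
  proof
    assume "\<exists>k. (shift_op (dilate A) \<mu> ^^ k) h = 0"
    then obtain k where "(shift_op (dilate A) \<mu> ^^ k) h = 0" by (rule exE)
    then have "(shift_op (dilate A) \<mu> ^^ Suc k) h = 0"
      by (rule shift_op_pow_mono[OF lin_dilate]) simp
    then show "\<exists>k\<ge>1. (shift_op (dilate A) \<mu> ^^ k) h = 0"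
      by (intro exI[of _ "Suc k"] conjI) simp_all
  qed (elim exE conjE, rule exI)
  then show ?thesis
    unfolding homogeneous_space_def set_eq_iff mem_Collect_eq homogeneous_class_iff gen_eig_iff
    by blast
qed

text \<open>The injectivity of \<open>C\<close> lets \<open>(F - \<mu>I)\<^sup>k (C Y) = C ((L - \<mu>I)\<^sup>k Y)\<close> vanish only if
  \<open>(L - \<mu>I)\<^sup>k Y\<close> does.\<close>

lemma gen_eig_intertwine:
  assumes C: "lin C" and inj: "inj_on C V" and V: "cfun.subspace V"
    and L: "\<And>Y. Y \<in> V \<Longrightarrow> L Y \<in> V" and comm: "\<And>Y. C (L Y) = F (C Y)"
  shows "gen_eig (C ` V) F \<mu> = C ` gen_eig V L \<mu>"
proof -
  have LV: "(shift_op L \<mu> ^^ k) Y \<in> V" if "Y \<in> V" for k Y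
  proof (induction k)
    case (Suc k)
    then show ?case
      unfolding funpow.simps comp_apply shift_op_def[of L \<mu>]
      by (intro cfun.subspace_diff[OF V] cfun.subspace_scale[OF V] L)
  qed (use that in simp)
  have shift: "C (shift_op L \<mu> Y) = shift_op F \<mu> (C Y)" for Y
    unfolding shift_op_def linD(2,4)[OF C] comm ..
  have pow: "C ((shift_op L \<mu> ^^ k) Y) = (shift_op F \<mu> ^^ k) (C Y)" for k Y
    by (induction k) (simp_all add: shift)
  have "(shift_op F \<mu> ^^ k) (C Y) = 0 \<longleftrightarrow> (shift_op L \<mu> ^^ k) Y = 0" if "Y \<in> V" for k Y
    using inj_on_eq_iff[OF inj LV[OF that] cfun.subspace_0[OF V]] linD(3)[OF C]
    unfolding pow[symmetric] by metis
  then show ?thesis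
    unfolding set_eq_iff image_iff gen_eig_iff Bex_def by blast
qed

section \<open>Homogeneous functions in the span of the translates\<close>

lemma order_linear_powers:
  fixes \<mu> :: complex
  assumes "finite I"
  shows "order \<mu> (\<Prod>\<nu>\<in>I. [:- \<nu>, 1:] ^ r \<nu>) = (if \<mu> \<in> I then r \<mu> else 0)"
  using assms
proof (induction I rule: finite_induct)
  case (insert \<nu> I)
  have "[:- \<nu>, 1:] ^ r \<nu> * (\<Prod>\<nu>\<in>I. [:- \<nu>, 1:] ^ r \<nu>) \<noteq> 0"
    using insert.hyps by auto
  then show ?case
    using insert by (auto simp: order_mult order_linear_power)
qed simp

theorem mainTheorem3:
  fixes \<Gamma> \<Lambda> D \<Lambda>' :: "(real^'d) set"
    and A :: "real^'d^'d"
    and c \<phi> :: "real^'d \<Rightarrow> complex"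
    and \<Omega> :: "nat \<Rightarrow> (real^'d) set"
    and n\<^sub>0 n m :: nat
    and \<Delta> :: "complex set"
    and r :: "complex \<Rightarrow> nat"
    and \<B> :: "(real^'d \<Rightarrow> complex) set"
  assumes "is_lattice \<Gamma>"
    and "is_dilation \<Gamma> A"
    and "finite \<Lambda>" and "\<Lambda> \<noteq> {}" and "\<Lambda> \<subseteq> \<Gamma>"
    and "\<forall>k\<in>\<Gamma> - \<Lambda>. c k = 0"
    and "compactly_supported \<phi>"
    and "\<forall>x. \<phi> x = (\<Sum>k\<in>\<Lambda>. c k * \<phi> (A *v x - k))"
    and "tiling_digits \<Gamma> A D"
    and "\<Lambda>' = {k - d | k d. k \<in> \<Lambda> \<and> d \<in> D}"
    and "\<forall>i. finite (\<Omega> i) \<and> \<Omega> i \<subseteq> \<Gamma>"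
    and "\<Omega> 0 = lattice_attractor \<Gamma> A \<Lambda>"
    and "\<forall>i. \<Omega> i \<subset> \<Omega> (Suc i)"
    and "(\<Union>i. \<Omega> i) = \<Gamma>"
    and "\<forall>i. admissible \<Gamma> A \<Lambda> (\<Omega> i) \<and> w_map A \<Lambda> (\<Omega> (Suc i)) \<inter> \<Gamma> \<subseteq> \<Omega> i"
    and "\<Omega> n\<^sub>0 = lattice_attractor \<Gamma> A \<Lambda>'"
    and "\<forall>i\<ge>n\<^sub>0. admissible \<Gamma> A \<Lambda>' (\<Omega> i) \<and> w_map A \<Lambda>' (\<Omega> (Suc i)) \<inter> \<Gamma> \<subseteq> \<Omega> i"
    and "translates_independent \<Gamma> \<phi>"
    and "m = card (\<Omega> n)"
    and "\<Delta> = {\<mu>. eigenvalue (fin_matrix (\<Omega> n) (refine_entry A c)) \<mu>}"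
    and "char_poly (fin_matrix (\<Omega> n) (refine_entry A c)) = (\<Prod>\<mu>\<in>\<Delta>. [:- \<mu>, 1:] ^ r \<mu>)"
    and "0 \<notin> \<Delta> \<longrightarrow> r 0 = 0"
    and "jordan_basis (\<Omega> n) (refine_entry A c) \<B>"
  shows "(\<forall>\<mu>\<in>\<Delta> - {0}.
      let \<B>\<^sub>\<mu> = {v \<in> \<B>. associated (\<Omega> n) (refine_entry A c) \<mu> v};
          h = (\<lambda>v. combine \<Gamma> \<phi> (extension_seq \<Gamma> (\<Omega> n) (refine_entry A c) \<mu> v))
      in finite_dimensional (homogeneous_space \<Gamma> A \<phi> \<mu>) \<and>
         cfun.dim (homogeneous_space \<Gamma> A \<phi> \<mu>) = r \<mu> \<and>
         inj_on h \<B>\<^sub>\<mu> \<and> is_basis (h ` \<B>\<^sub>\<mu>) (homogeneous_space \<Gamma> A \<phi> \<mu>))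
    \<and> (let \<H> = space_sum (\<Delta> - {0}) (homogeneous_space \<Gamma> A \<phi>)
       in sum_is_direct (\<Delta> - {0}) (homogeneous_space \<Gamma> A \<phi>) \<and>
          \<H> \<subseteq> translate_space \<Gamma> \<phi> \<and>
          finite_dimensional \<H> \<and>
          int (cfun.dim \<H>) = int m - int (r 0))"
proof -
  let ?M = "refine_entry A c"
  let ?T = "row_mult (\<Omega> n) ?M" and ?L = "row_mult \<Gamma> ?M"
  note \<Gamma> = assms(1) and A = assms(2)
  have A\<Gamma>: "A *v i \<in> \<Gamma>" if "i \<in> \<Gamma>" for i
    using A that by (auto simp: is_dilation_def)
  have inv: "A *v (matrix_inv A *v x) = x" "matrix_inv A *v (A *v x) = x" for x
    by (rule matrix_inv_mult_vec; rule dilation_ker[OF A]; assumption)+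
  \<comment> \<open>The rows meeting column \<open>j\<close> of the matrix: \<open>c (A k - j) \<noteq> 0\<close> forces \<open>A k \<in> j + \<Lambda>\<close>. So
    admissibility turns the given sets into a filtration as studied above.\<close>
  have w: "k \<in> w_map A \<Lambda> S \<inter> \<Gamma>" if "j \<in> S" "S \<subseteq> \<Gamma>" "k \<in> \<Gamma>" "?M k j \<noteq> 0" for j k S
  proof -
    have "A *v k - j \<in> \<Gamma>"
      using that A\<Gamma> lattice_closed(1)[OF \<Gamma>] by blast
    then have "A *v k - j \<in> \<Lambda>"
      using that assms(6) by (auto simp: refine_entry_def)
    moreover have "k = matrix_inv A *v (j + (A *v k - j))" by (simp add: inv)
    ultimately show ?thesis using that unfolding w_map_def by blast
  qed
  interpret column_filtration \<Gamma> ?M \<Omega>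
  proof
    show "\<Omega> i \<subseteq> \<Omega> (Suc i)" for i using assms(13) by blast
    show "(\<Union>i. \<Omega> i) = \<Gamma>" by fact
    show "k \<in> \<Omega> 0" if "j \<in> \<Omega> 0" "k \<in> \<Gamma>" "?M k j \<noteq> 0" for j k
      using w[of j "\<Omega> 0" k] that assms(11,15) by (auto simp: admissible_def)
    show "k \<in> \<Omega> i" if "j \<in> \<Omega> (Suc i)" "k \<in> \<Gamma>" "?M k j \<noteq> 0" for i j k
      using w[of j "\<Omega> (Suc i)" k] that assms(11,15) by blast
  qed
  have fin: "finite (\<Omega> n)" using assms(11) by blast
  obtain \<alpha> where finB: "finite \<B>" and \<alpha>: "\<And>b. b \<in> \<B> \<Longrightarrow> b \<in> gen_eig (seqs (\<Omega> n)) ?T (\<alpha> b)"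
    and card\<alpha>: "\<And>\<mu>. card {b \<in> \<B>. \<alpha> b = \<mu>} = order \<mu> (char_poly (fin_matrix (\<Omega> n) ?M))"
    by (rule jordan_basis_gen_eig[OF fin assms(23)]) blast
  have basisB: "is_basis \<B> (seqs (\<Omega> n))"
    using assms(23) unfolding jordan_basis_def by blast
  have carrier: "fin_matrix (\<Omega> n) ?M \<in> carrier_mat (card (\<Omega> n)) (card (\<Omega> n))"
    by (simp add: fin_matrix_def)
  have \<Delta>: "\<mu> \<in> \<Delta> \<longleftrightarrow> poly (char_poly (fin_matrix (\<Omega> n) ?M)) \<mu> = 0" for \<mu>
    unfolding assms(20) using eigenvalue_root_char_poly[OF carrier] by simp
  have nz: "char_poly (fin_matrix (\<Omega> n) ?M) \<noteq> 0"
    using degree_monic_char_poly[OF carrier] by auto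
  have fin\<Delta>: "finite \<Delta>"
    by (rule finite_subset[OF _ poly_roots_finite[OF nz]]) (use \<Delta> in blast)
  have card_r: "card {b \<in> \<B>. \<alpha> b = \<mu>} = r \<mu>" if "\<mu> \<in> \<Delta>" for \<mu>
    unfolding card\<alpha> assms(21) order_linear_powers[OF fin\<Delta>] using that by simp
  have assoc: "{v \<in> \<B>. associated (\<Omega> n) ?M \<mu> v} = {b \<in> \<B>. \<alpha> b = \<mu>}" for \<mu>
  proof -
    have "associated (\<Omega> n) ?M \<mu> b \<longleftrightarrow> \<alpha> b = \<mu>" if b: "b \<in> \<B>" for b
    proof -
      have bS: "b \<in> seqs (\<Omega> n)" using \<alpha>[OF b] by (simp add: gen_eig_iff)
      have b0: "b \<noteq> 0"
        using basisB b cfun.dependent_zero[of \<B>] unfolding is_basis_def by blast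
      have "\<alpha> b = \<mu>" if b\<mu>: "b \<in> gen_eig (seqs (\<Omega> n)) ?T \<mu>"
      proof (rule ccontr)
        assume neq: "\<alpha> b \<noteq> \<mu>"
        obtain k l where "(shift_op ?T (\<alpha> b) ^^ k) b = 0" "(shift_op ?T \<mu> ^^ l) b = 0"
          using \<alpha>[OF b] b\<mu> unfolding gen_eig_iff by blast
        then have "b = 0" by (rule gen_eig_disjoint[OF lin_row_mult neq])
        then show False using b0 by simp
      qed
      then show ?thesis
        using associated_iff[OF bS] b0 \<alpha>[OF b] by blast
    qed
    then show ?thesis by blast
  qed
  have comm: "combine \<Gamma> \<phi> (?L Y) = dilate A (combine \<Gamma> \<phi> Y)" for Y
  proof
    fix x
    show "combine \<Gamma> \<phi> (?L Y) x = dilate A (combine \<Gamma> \<phi> Y) x"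
      using combine_row_mult[OF \<Gamma> A assms(3,5,6,7,8), of Y "matrix_inv A *v x"]
      by (simp add: inv dilate_def)
  qed
  note inj = inj_on_combine[OF \<Gamma> assms(18)]
  \<comment> \<open>Linear independence enters here: it makes \<open>Y \<mapsto> Y\<Phi>\<close> an injection, which intertwines \<open>L\<close>
    with the dilation.\<close>
  have H: "homogeneous_space \<Gamma> A \<phi> \<mu> = combine \<Gamma> \<phi> ` gen_eig (seqs \<Gamma>) ?L \<mu>" for \<mu>
    unfolding homogeneous_space_eq translate_space_def
    by (rule gen_eig_intertwine[where L = ?L])
      (rule lin_combine inj subspace_seqs row_mult_in_seqs comm)+
  define h where "h \<mu> = (\<lambda>v. combine \<Gamma> \<phi> (extension_seq \<Gamma> (\<Omega> n) ?M \<mu> v))" for \<mu>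
  define B where "B \<mu> = {b \<in> \<B>. \<alpha> b = \<mu>}" for \<mu>
  have finB\<mu>: "finite (B \<mu>)" for \<mu> using finB by (simp add: B_def)
  have main: "inj_on (h \<mu>) (B \<mu>)" "is_basis (h \<mu> ` B \<mu>) (homogeneous_space \<Gamma> A \<phi> \<mu>)"
    if \<mu>: "\<mu> \<noteq> 0" for \<mu>
  proof -
    let ?G = "gen_eig (seqs \<Gamma>) ?L \<mu>" and ?E = "extension_seq \<Gamma> (\<Omega> n) ?M \<mu>"
    have basisT: "is_basis (B \<mu>) (gen_eig (seqs (\<Omega> n)) ?T \<mu>)"
      unfolding B_def by (rule is_basis_gen_eig[OF lin_row_mult basisB finB \<alpha>])
    have E: "?E b \<in> ?G \<and> restr (\<Omega> n) (?E b) = b" if "b \<in> B \<mu>" for b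
      using extension_seq[OF \<mu>, of n b] that assoc[of \<mu>] unfolding B_def by blast
    have lift: "inj_on ?E (B \<mu>)" "is_basis (?E ` B \<mu>) ?G"
      by (rule is_basis_lift[OF lin_restr subspace_gen_eig[OF lin_row_mult subspace_seqs] finB\<mu>
            inj_on_restr[OF \<mu>, of n]]; use E basisT restr_gen_eig in \<open>auto simp: is_basis_def\<close>)+
    have injG: "inj_on (combine \<Gamma> \<phi>) ?G"
      using inj by (rule inj_on_subset) (auto simp: gen_eig_iff)
    have EG: "?E ` B \<mu> \<subseteq> ?G" using E by blast
    have h: "h \<mu> = combine \<Gamma> \<phi> \<circ> ?E" by (simp add: h_def fun_eq_iff)
    show "inj_on (h \<mu>) (B \<mu>)"
      unfolding h by (rule comp_inj_on[OF lift(1) inj_on_subset[OF injG EG]])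
    show "is_basis (h \<mu> ` B \<mu>) (homogeneous_space \<Gamma> A \<phi> \<mu>)"
      unfolding h H image_comp[symmetric] by (rule is_basis_image[OF lin_combine lift(2) injG])
  qed
  have card_h: "card (h \<mu> ` B \<mu>) = r \<mu>" if "\<mu> \<in> \<Delta> - {0}" for \<mu>
    using that main(1)[of \<mu>] card_r[of \<mu>] by (simp add: card_image B_def)
  have part1: "finite_dimensional (homogeneous_space \<Gamma> A \<phi> \<mu>) \<and>
      cfun.dim (homogeneous_space \<Gamma> A \<phi> \<mu>) = r \<mu> \<and>
      inj_on (h \<mu>) (B \<mu>) \<and> is_basis (h \<mu> ` B \<mu>) (homogeneous_space \<Gamma> A \<phi> \<mu>)"
    if "\<mu> \<in> \<Delta> - {0}" for \<mu>
    using that main[of \<mu>] card_h[OF that] finite_basis_dim[of "h \<mu> ` B \<mu>"] finB\<mu>[of \<mu>] by auto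
  let ?I = "\<Delta> - {0}" and ?V = "homogeneous_space \<Gamma> A \<phi>"
  have direct: "sum_is_direct ?I ?V"
    unfolding sum_is_direct_def homogeneous_space_eq
  proof (intro allI impI, elim conjE)
    fix f assume "\<forall>\<mu>\<in>?I. f \<mu> \<in> gen_eig (translate_space \<Gamma> \<phi>) (dilate A) \<mu>" "(\<Sum>\<mu>\<in>?I. f \<mu>) = 0"
    then show "\<forall>\<mu>\<in>?I. f \<mu> = 0"
      by (rule gen_eig_direct[OF lin_dilate finite_Diff[OF fin\<Delta>]])
  qed
  have basisH: "is_basis (\<Union>\<mu>\<in>?I. h \<mu> ` B \<mu>) (space_sum ?I ?V)"
    and cardH: "card (\<Union>\<mu>\<in>?I. h \<mu> ` B \<mu>) = (\<Sum>\<mu>\<in>?I. card (h \<mu> ` B \<mu>))"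
    by (rule is_basis_space_sum[OF _ _ _ direct]; use fin\<Delta> finB\<mu> main(2) in auto)+
  have finH: "finite (\<Union>\<mu>\<in>?I. h \<mu> ` B \<mu>)" using fin\<Delta> finB\<mu> by auto
  have "\<alpha> ` \<B> \<subseteq> \<Delta>"
  proof
    fix \<mu> assume "\<mu> \<in> \<alpha> ` \<B>"
    then have "{b \<in> \<B>. \<alpha> b = \<mu>} \<noteq> {}" by auto
    then have "order \<mu> (char_poly (fin_matrix (\<Omega> n) ?M)) \<noteq> 0"
      using finB unfolding card\<alpha>[symmetric] by simp
    then show "\<mu> \<in> \<Delta>"
      unfolding \<Delta> using order_root by blast
  qed
  then have "card \<B> = (\<Sum>\<mu>\<in>\<Delta>. card {b \<in> \<B>. \<alpha> b = \<mu>})"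
    using sum.group[OF finB fin\<Delta>, of \<alpha> "\<lambda>_. 1::nat"] by simp
  also have "\<dots> = (\<Sum>\<mu>\<in>\<Delta>. r \<mu>)"
    using card_r by simp
  finally have "m = (\<Sum>\<mu>\<in>\<Delta>. r \<mu>)"
    using assms(19) card_basis_seqs[OF fin basisB] by simp
  then have m: "m = r 0 + (\<Sum>\<mu>\<in>?I. r \<mu>)"
    using assms(22) fin\<Delta> by (cases "0 \<in> \<Delta>") (auto simp: sum.remove)
  have "cfun.dim (space_sum ?I ?V) = (\<Sum>\<mu>\<in>?I. r \<mu>)"
    using finite_basis_dim(2)[OF finH basisH] cardH card_h by simp
  then have dimH: "int (cfun.dim (space_sum ?I ?V)) = int m - int (r 0)"
    using m by simp
  have "cfun.subspace (translate_space \<Gamma> \<phi>)"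
    unfolding translate_space_def by (rule fpair.linear_subspace_image[OF lin_combine subspace_seqs])
  then have sub: "space_sum ?I ?V \<subseteq> translate_space \<Gamma> \<phi>"
    unfolding space_sum_def homogeneous_space_def by (auto intro: cfun.subspace_sum)
  show ?thesis
    unfolding Let_def assoc
  proof (intro conjI)
    show "\<forall>\<mu>\<in>?I. finite_dimensional (?V \<mu>) \<and> cfun.dim (?V \<mu>) = r \<mu> \<and>
        inj_on (\<lambda>v. combine \<Gamma> \<phi> (extension_seq \<Gamma> (\<Omega> n) ?M \<mu> v)) {b \<in> \<B>. \<alpha> b = \<mu>} \<and>
        is_basis ((\<lambda>v. combine \<Gamma> \<phi> (extension_seq \<Gamma> (\<Omega> n) ?M \<mu> v)) ` {b \<in> \<B>. \<alpha> b = \<mu>}) (?V \<mu>)"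
      using part1 unfolding B_def h_def by (rule ballI)
  qed (fact direct sub finite_basis_dim(1)[OF finH basisH] dimH)+
qed

end
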